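(* The problem $1|r_i|\sum f_i(C_i)$ can be solved in $O^*(3^n)$ time and space, where $n$ is the number of jobs.
   Context: Problem $1|r_i|\sum f_i(C_i)$: given $n$ jobs, each job $i$ with processing time $p_i$, release date $r_i\ge 0$ (it cannot start before $r_i$) and a non-decreasing cost function $f_i$, find a sequence of the jobs on a single machine (one job at a time, no preemption, each job starting as early as possible) minimizing $\sum_i f_i(C_i)$, where $C_i$ is the completion time of job $i$. Notation: $f(n)=O^*(g(n))$ means $f(n)=O(p(n)g(n))$ for some polynomial $p$. *)

theory Defs
  imports
    Complex_Main
    "HOL-Library.Landau_Symbols"
    "HOL-Computational_Algebra.Polynomial"
    "HOL-Combinatorics.Multiset_Permutations"
begin

section \<open>The scheduling problem $1|r_i|\sum f_i(C_i)$\<close>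

text \<open>
  Jobs are numbered \<open>0, \<dots>, n - 1\<close>. Values of \<open>p\<close>, \<open>r\<close>, \<open>f\<close> at other indices are irrelevant.
  Monotonicity of \<open>f i\<close> is only needed for nonnegative times.
\<close>

definition valid_instance ::
    "nat \<Rightarrow> (nat \<Rightarrow> real) \<Rightarrow> (nat \<Rightarrow> real) \<Rightarrow> (nat \<Rightarrow> real \<Rightarrow> real) \<Rightarrow> bool" where
  "valid_instance n p r f \<longleftrightarrow>
     (\<forall>i<n. 0 \<le> p i \<and> 0 \<le> r i \<and> mono_on {0..} (f i))"

text \<open>
  The completion times when the machine is free from time \<open>t\<close> on and processes the listed jobs
  in this order, each starting as early as possible.
\<close>

primrec completion ::
    "(nat \<Rightarrow> real) \<Rightarrow> (nat \<Rightarrow> real) \<Rightarrow> real \<Rightarrow> nat list \<Rightarrow> nat \<Rightarrow> real" where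
  "completion p r t [] = (\<lambda>_. 0)"
| "completion p r t (i # is) =
     (let c = max t (r i) + p i in (completion p r c is)(i := c))"

definition total_cost ::
    "nat \<Rightarrow> (nat \<Rightarrow> real) \<Rightarrow> (nat \<Rightarrow> real) \<Rightarrow> (nat \<Rightarrow> real \<Rightarrow> real) \<Rightarrow> nat list \<Rightarrow> real" where
  "total_cost n p r f \<sigma> = (\<Sum>i<n. f i (completion p r 0 \<sigma> i))"

definition optimal_sequence ::
    "nat \<Rightarrow> (nat \<Rightarrow> real) \<Rightarrow> (nat \<Rightarrow> real) \<Rightarrow> (nat \<Rightarrow> real \<Rightarrow> real) \<Rightarrow> nat list \<Rightarrow> bool" where
  "optimal_sequence n p r f \<sigma> \<longleftrightarrow>
     is_arg_min (total_cost n p r f) (\<lambda>\<tau>. \<tau> \<in> permutations_of_set {..<n}) \<sigma>"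


section \<open>A random access machine\<close>

text \<open>
  Since time and space are measured in the number of jobs alone, arithmetic on the numerical data
  has unit cost and the cost functions are given as oracles with unit-cost evaluation. The machine
  has word registers and word arrays (natural numbers, used for counting and addressing) and number
  registers and number arrays (reals). Numbers can be copied, added, subtracted, compared and
  passed to the oracles, but never converted to words. There are no number constants, so a program
  is a finite object.

  The parameter \<open>m\<close> is the memory size: an array cell is accessible only if its index is below
  \<open>m\<close>, and an instruction whose result is a word not below \<open>m\<close> fails. So words consist of
  \<open>log\<^sub>2 m\<close> bits, and a program uses at most \<open>m\<close> cells of each of the finitely many arrays
  it mentions, plus a constant number of registers.
\<close>

type_synonym name = string

record state =
  wreg :: "name \<Rightarrow> nat"
  warr :: "name \<Rightarrow> nat \<Rightarrow> nat"
  nreg :: "name \<Rightarrow> real"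
  narr :: "name \<Rightarrow> nat \<Rightarrow> real"

datatype instr =
    WConst name nat         \<comment> \<open>\<open>x := k\<close>\<close>
  | WAdd name name name     \<comment> \<open>\<open>x := y + z\<close>\<close>
  | WSub name name name     \<comment> \<open>\<open>x := y - z\<close>, truncated at 0\<close>
  | WLoad name name name    \<comment> \<open>\<open>x := a[i]\<close>\<close>
  | WStore name name name   \<comment> \<open>\<open>a[i] := x\<close>\<close>
  | NAdd name name name
  | NSub name name name
  | NLoad name name name
  | NStore name name name
  | Oracle name name name   \<comment> \<open>\<open>x := f\<^sub>i(y)\<close>\<close>

datatype test =
    WLess name name
  | NLess name name

datatype prog =
    Skip
  | Instr instr
  | Seq prog prog
  | Cond test prog prog
  | While test prog

primrec run_instr ::
    "(nat \<Rightarrow> real \<Rightarrow> real) \<Rightarrow> nat \<Rightarrow> instr \<Rightarrow> state \<Rightarrow> state option" where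
  "run_instr f m (WConst x k) s =
     (if k < m then Some (s\<lparr>wreg := (wreg s)(x := k)\<rparr>) else None)"
| "run_instr f m (WAdd x y z) s =
     (if wreg s y + wreg s z < m
      then Some (s\<lparr>wreg := (wreg s)(x := wreg s y + wreg s z)\<rparr>) else None)"
| "run_instr f m (WSub x y z) s =
     (if wreg s y - wreg s z < m
      then Some (s\<lparr>wreg := (wreg s)(x := wreg s y - wreg s z)\<rparr>) else None)"
| "run_instr f m (WLoad x a i) s =
     (if wreg s i < m
      then Some (s\<lparr>wreg := (wreg s)(x := warr s a (wreg s i))\<rparr>) else None)"
| "run_instr f m (WStore a i x) s =
     (if wreg s i < m
      then Some (s\<lparr>warr := (warr s)(a := (warr s a)(wreg s i := wreg s x))\<rparr>) else None)"
| "run_instr f m (NAdd x y z) s =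
     Some (s\<lparr>nreg := (nreg s)(x := nreg s y + nreg s z)\<rparr>)"
| "run_instr f m (NSub x y z) s =
     Some (s\<lparr>nreg := (nreg s)(x := nreg s y - nreg s z)\<rparr>)"
| "run_instr f m (NLoad x a i) s =
     (if wreg s i < m
      then Some (s\<lparr>nreg := (nreg s)(x := narr s a (wreg s i))\<rparr>) else None)"
| "run_instr f m (NStore a i x) s =
     (if wreg s i < m
      then Some (s\<lparr>narr := (narr s)(a := (narr s a)(wreg s i := nreg s x))\<rparr>) else None)"
| "run_instr f m (Oracle x i y) s =
     Some (s\<lparr>nreg := (nreg s)(x := f (wreg s i) (nreg s y))\<rparr>)"

primrec holds :: "test \<Rightarrow> state \<Rightarrow> bool" where
  "holds (WLess x y) s \<longleftrightarrow> wreg s x < wreg s y"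
| "holds (NLess x y) s \<longleftrightarrow> nreg s x < nreg s y"

text \<open>
  \<open>exec f m c s t s'\<close>: with oracles \<open>f\<close> and memory size \<open>m\<close>, the program \<open>c\<close> started in \<open>s\<close>
  terminates without failure after \<open>t\<close> steps in state \<open>s'\<close>.
\<close>

inductive exec ::
    "(nat \<Rightarrow> real \<Rightarrow> real) \<Rightarrow> nat \<Rightarrow> prog \<Rightarrow> state \<Rightarrow> nat \<Rightarrow> state \<Rightarrow> bool"
  for f m where
  Skip: "exec f m Skip s 1 s"
| Instr: "run_instr f m a s = Some s' \<Longrightarrow> exec f m (Instr a) s 1 s'"
| Seq: "exec f m c s t s' \<Longrightarrow> exec f m d s' t' s'' \<Longrightarrow> exec f m (Seq c d) s (t + t') s''"
| CondTrue: "holds b s \<Longrightarrow> exec f m c s t s' \<Longrightarrow> exec f m (Cond b c d) s (Suc t) s'"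
| CondFalse: "\<not> holds b s \<Longrightarrow> exec f m d s t s' \<Longrightarrow> exec f m (Cond b c d) s (Suc t) s'"
| WhileFalse: "\<not> holds b s \<Longrightarrow> exec f m (While b c) s 1 s"
| WhileTrue: "holds b s \<Longrightarrow> exec f m c s t s' \<Longrightarrow> exec f m (While b c) s' t' s'' \<Longrightarrow>
    exec f m (While b c) s (Suc (t + t')) s''"

lemma exec_deterministic:
  "exec f m c s t s' \<Longrightarrow> exec f m c s u s'' \<Longrightarrow> t = u \<and> s' = s''"
proof (induction arbitrary: u s'' rule: exec.induct)
  case (Seq c s t s' d t' s'')
  from Seq.prems show ?case by cases (use Seq.IH in blast)
next
  case (CondTrue b s c t s' d)
  from CondTrue.prems show ?case by cases (use CondTrue in blast)+
next
  case (CondFalse b s d t s' c)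
  from CondFalse.prems show ?case by cases (use CondFalse in blast)+
next
  case (WhileTrue b s c t s' t' s'')
  from WhileTrue.prems show ?case by cases (use WhileTrue in blast)+
qed (auto elim: exec.cases)


section \<open>Solving the problem within given time and space\<close>

definition initial_state :: "nat \<Rightarrow> (nat \<Rightarrow> real) \<Rightarrow> (nat \<Rightarrow> real) \<Rightarrow> state" where
  "initial_state n p r =
     \<lparr>wreg = (\<lambda>_. 0)(''n'' := n),
      warr = (\<lambda>_ _. 0),
      nreg = (\<lambda>_. 0),
      narr = (\<lambda>_ _. 0)(''p'' := (\<lambda>i. if i < n then p i else 0),
                       ''r'' := (\<lambda>i. if i < n then r i else 0))\<rparr>"

definition output_sequence :: "nat \<Rightarrow> state \<Rightarrow> nat list" where
  "output_sequence n s = map (warr s ''seq'') [0..<n]"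

text \<open>\<open>n < S n\<close> says that the input fits into the memory; with it, every word ever stored while
  processing an instance with \<open>n\<close> jobs is below \<open>S n\<close>.\<close>

definition solves_scheduling :: "prog \<Rightarrow> (nat \<Rightarrow> nat) \<Rightarrow> (nat \<Rightarrow> nat) \<Rightarrow> bool" where
  "solves_scheduling c T S \<longleftrightarrow>
     (\<forall>n. n < S n) \<and>
     (\<forall>n p r f. valid_instance n p r f \<longrightarrow>
        (\<exists>t s. exec f (S n) c (initial_state n p r) t s \<and> t \<le> T n \<and>
               optimal_sequence n p r f (output_sequence n s)))"

definition Ostar :: "(nat \<Rightarrow> real) \<Rightarrow> (nat \<Rightarrow> real) set" where
  "Ostar g = {h. \<exists>q :: real poly. h \<in> O(\<lambda>n. poly q (real n) * g n)}"

end

(*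
  A schedule splits into blocks without idle time. The completion time of the jobs sequenced so far
  is determined by the first job j of the current block and the set of jobs in that block, namely
  r j plus the processing times in the block. A state therefore records which jobs are unscheduled,
  in the current block, or in an earlier block (a ternary number below 3^n), together with j. The
  next job determines the next state, so Bellman's principle holds although several completion
  times are possible for the same set of jobs. Scheduling a job increases the ternary number, and
  evaluating the states in decreasing order takes O(n) steps for each of the (n + 1) 3^n states.
*)
theory Submission
  imports Defs
begin

section \<open>Sequencing from a given time\<close>

text \<open>The table stores the cost still to be paid, not the cost already paid: the former
  depends on the history only through the completion time and the set of jobs left, and following
  stored successors from the start yields the sequence in processing order. Bellman's equation is
  proved at every pair (c, j), including pairs that no schedule reaches, because times and
  transitions make sense for every code below 3^n; reachable pairs never have to be characterized.
  The machine shapes the rest. Numbers cannot become words, so a completion time can enter an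
  address only through (c, j). There is no multiplication or division, so powers of 3 and multiples
  of 3^n are tabulated by additions, and digits are split off by subtraction. The index j takes n +
  1 values, since a block may also start at time 0, when the machine becomes free.\<close>

locale scheduling_instance =
  fixes n :: nat and p r :: "nat \<Rightarrow> real" and f :: "nat \<Rightarrow> real \<Rightarrow> real"
begin

definition finish :: "real \<Rightarrow> nat \<Rightarrow> real" where
  "finish t i = max t (r i) + p i"

primrec cost_from :: "real \<Rightarrow> nat list \<Rightarrow> real" where
  "cost_from t [] = 0"
| "cost_from t (i # is) = f i (finish t i) + cost_from (finish t i) is"

definition optimal_cost :: "real \<Rightarrow> nat set \<Rightarrow> real" where
  "optimal_cost t U = Min (cost_from t ` permutations_of_set U)"

definition optimal_from :: "real \<Rightarrow> nat set \<Rightarrow> nat list \<Rightarrow> bool" where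
  "optimal_from t U \<sigma> \<longleftrightarrow> \<sigma> \<in> permutations_of_set U \<and> cost_from t \<sigma> = optimal_cost t U"

definition cost_via :: "real \<Rightarrow> nat set \<Rightarrow> nat \<Rightarrow> real" where
  "cost_via t U i = f i (finish t i) + optimal_cost (finish t i) (U - {i})"

text \<open>Distinctness makes the induction work: the update \<open>(i := c)\<close> for the first
  job must not overwrite the completion time of a later one.\<close>

lemma sum_completion:
  "distinct \<sigma> \<Longrightarrow> (\<Sum>i\<in>set \<sigma>. f i (completion p r t \<sigma> i)) = cost_from t \<sigma>"
proof (induction \<sigma> arbitrary: t)
  case (Cons a \<sigma>)
  have "(\<Sum>i\<in>set \<sigma>. f i (completion p r t (a # \<sigma>) i)) =
      (\<Sum>i\<in>set \<sigma>. f i (completion p r (finish t a) \<sigma> i))"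
    using Cons.prems by (intro sum.cong) (auto simp: Let_def finish_def)
  then show ?case
    using Cons by (simp add: Let_def finish_def)
qed simp

lemma total_cost_eq:
  "\<sigma> \<in> permutations_of_set {..<n} \<Longrightarrow> total_cost n p r f \<sigma> = cost_from 0 \<sigma>"
  using sum_completion[of \<sigma> 0] by (auto simp: total_cost_def permutations_of_set_def)

lemma optimal_cost_le:
  "finite U \<Longrightarrow> \<sigma> \<in> permutations_of_set U \<Longrightarrow> optimal_cost t U \<le> cost_from t \<sigma>"
  by (auto simp: optimal_cost_def)

lemma ex_optimal_from:
  assumes "finite U"
  obtains \<sigma> where "optimal_from t U \<sigma>"
proof -
  have "Min (cost_from t ` permutations_of_set U) \<in> cost_from t ` permutations_of_set U"
    using assms by (intro Min_in) auto
  then show ?thesis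
    using that by (auto simp: optimal_from_def optimal_cost_def)
qed

lemma optimal_cost_empty [simp]: "optimal_cost t {} = 0"
  by (simp add: optimal_cost_def)

lemma optimal_from_imp_optimal_sequence:
  "optimal_from 0 {..<n} \<sigma> \<Longrightarrow> optimal_sequence n p r f \<sigma>"
  by (auto simp: optimal_sequence_def is_arg_min_def optimal_from_def total_cost_eq not_less
      intro: optimal_cost_le)

lemma optimal_cost_le_cost_via:
  assumes "finite U" "i \<in> U"
  shows "optimal_cost t U \<le> cost_via t U i"
proof -
  obtain \<sigma> where "optimal_from (finish t i) (U - {i}) \<sigma>"
    using assms ex_optimal_from by blast
  moreover from this have "i # \<sigma> \<in> permutations_of_set U"
    using assms by (auto simp: optimal_from_def permutations_of_set_def)
  ultimately show ?thesis
    using optimal_cost_le[OF assms(1), of "i # \<sigma>" t] by (simp add: cost_via_def optimal_from_def)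
qed

text \<open>Bellman's equation, in a form that a loop over candidates can establish. The head
  \<open>a\<close> of an optimal sequence satisfies
  \<open>cost_via t U a \<le> optimal_cost t U\<close>, because its tail costs at least the optimum
  for \<open>U - {a}\<close>; a minimizing \<open>i\<close> is no worse than
  \<open>a\<close>.\<close>

lemma optimal_cost_eq_cost_via:
  assumes "finite U" "i \<in> U" and min: "\<And>i'. i' \<in> U \<Longrightarrow> cost_via t U i \<le> cost_via t U i'"
  shows "optimal_cost t U = cost_via t U i"
proof (rule antisym)
  obtain \<sigma> where \<sigma>: "optimal_from t U \<sigma>"
    using assms ex_optimal_from by blast
  then obtain a \<tau> where a: "\<sigma> = a # \<tau>"
    using \<open>i \<in> U\<close> by (cases \<sigma>) (auto simp: optimal_from_def permutations_of_set_def)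
  then have "a \<in> U" "\<tau> \<in> permutations_of_set (U - {a})"
    using \<sigma> by (auto simp: optimal_from_def permutations_of_set_def)
  then have "cost_via t U a \<le> cost_from t \<sigma>"
    using assms(1) by (simp add: cost_via_def a optimal_cost_le)
  then show "cost_via t U i \<le> optimal_cost t U"
    using min[OF \<open>a \<in> U\<close>] \<sigma> by (simp add: optimal_from_def)
qed (use assms optimal_cost_le_cost_via in auto)

lemma optimal_from_Cons:
  assumes "i \<in> U" "optimal_cost t U = cost_via t U i" "optimal_from (finish t i) (U - {i}) \<sigma>"
  shows "optimal_from t U (i # \<sigma>)"
  using assms by (auto simp: optimal_from_def cost_via_def permutations_of_set_def)


section \<open>States of the dynamic program\<close>

definition digit :: "nat \<Rightarrow> nat \<Rightarrow> nat" where
  "digit c i = c div 3 ^ i mod 3"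

text \<open>Digit 0 marks an unscheduled job, 1 a job of the current block, 2 a job of an earlier block.\<close>

definition unscheduled :: "nat \<Rightarrow> nat set" where
  "unscheduled c = {i. i < n \<and> digit c i = 0}"

text \<open>Adding this weight to \<open>c\<close> turns every digit 1 into 2, so one addition
  closes the current block.\<close>

definition block_code :: "nat \<Rightarrow> nat" where
  "block_code c = (\<Sum>i<n. if digit c i = 1 then 3 ^ i else 0)"

definition block_length :: "nat \<Rightarrow> real" where
  "block_length c = (\<Sum>i<n. if digit c i = 1 then p i else 0)"

text \<open>The index \<open>j = n\<close> stands for a block that starts at time 0.\<close>

definition block_start :: "nat \<Rightarrow> real" where
  "block_start j = (if j < n then r j else 0)"

definition time :: "nat \<Rightarrow> nat \<Rightarrow> real" where
  "time c j = block_start j + block_length c"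

text \<open>The machine idles before job \<open>i\<close> exactly when
  \<open>time c j < r i\<close>; then the old block is closed and \<open>i\<close> opens a new one.
  Otherwise \<open>i\<close> joins the block. In both cases \<open>3 ^ i\<close> raises the digit of
  an unscheduled \<open>i\<close> from 0 to 1.\<close>

definition next_code :: "nat \<Rightarrow> nat \<Rightarrow> nat \<Rightarrow> nat" where
  "next_code c j i = (if time c j < r i then c + 3 ^ i + block_code c else c + 3 ^ i)"

definition next_first :: "nat \<Rightarrow> nat \<Rightarrow> nat \<Rightarrow> nat" where
  "next_first c j i = (if time c j < r i then i else j)"

section \<open>Ternary expansions\<close>

lemma sum_digits_less:
  fixes d :: "nat \<Rightarrow> nat"
  assumes "\<And>i. i < k \<Longrightarrow> d i < 3"
  shows "(\<Sum>i<k. d i * 3 ^ i) < 3 ^ k"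
  using assms
proof (induction k)
  case (Suc k)
  have "d k \<le> 2"
    using Suc.prems[of k] by simp
  then have "d k * 3 ^ k \<le> 2 * 3 ^ k"
    by simp
  moreover have "(\<Sum>i<k. d i * 3 ^ i) < 3 ^ k"
    using Suc by auto
  ultimately have "(\<Sum>i<k. d i * 3 ^ i) + d k * 3 ^ k < 3 * 3 ^ k"
    by linarith
  then show ?case by simp
qed simp

lemma digit_sum_digits:
  fixes d :: "nat \<Rightarrow> nat"
  assumes "\<And>i. i < k \<Longrightarrow> d i < 3" "i < k"
  shows "digit (\<Sum>i<k. d i * 3 ^ i) i = d i"
  using assms
proof (induction k)
  case (Suc k)
  have less: "(\<Sum>i<k. d i * 3 ^ i) < 3 ^ k"
    using Suc.prems by (intro sum_digits_less) auto
  show ?case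
  proof (cases "i = k")
    case True
    then show ?thesis using Suc.prems less by (simp add: digit_def div_mult_self3)
  next
    case False
    then obtain l where l: "k = Suc (i + l)"
      using Suc.prems by (metis less_SucE less_imp_Suc_add)
    \<comment> \<open>The top term is a multiple of \<open>3 * 3 ^ i\<close>, so it does not affect
      digit \<open>i\<close>.\<close>
    have eq: "d k * 3 ^ k = (d k * 3 ^ l * 3) * 3 ^ i"
      by (simp add: l power_add)
    then have "digit (\<Sum>i<Suc k. d i * 3 ^ i) i = digit (\<Sum>i<k. d i * 3 ^ i) i"
      unfolding digit_def sum.lessThan_Suc eq by simp
    then show ?thesis using Suc False by auto
  qed
qed simp

lemma mod_power_Suc: "c mod 3 ^ Suc i = digit c i * 3 ^ i + c mod 3 ^ i"
  using mod_mult2_eq[of c "3 ^ i" 3] by (simp add: digit_def mult.commute)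

lemma digit_less [simp]: "digit c i < 3"
  by (simp add: digit_def)

lemma digit_0 [simp]: "digit 0 i = 0"
  by (simp add: digit_def)

lemma mod_power_eq_sum_digits: "c mod 3 ^ k = (\<Sum>i<k. digit c i * 3 ^ i)"
  by (induction k) (simp_all add: mod_power_Suc del: power_Suc)

lemma code_eq_sum_digits: "c < 3 ^ n \<Longrightarrow> c = (\<Sum>i<n. digit c i * 3 ^ i)"
  using mod_power_eq_sum_digits[of c n] by simp

section \<open>Effect of one transition on the digits and the completion time\<close>

lemma sum_update:
  fixes g :: "nat \<Rightarrow> 'a :: comm_monoid_add"
  assumes "i < n" "g i = 0"
  shows "(\<Sum>l<n. if l = i then a else g l) = a + (\<Sum>l<n. g l)"
proof -
  have "(\<Sum>l\<in>{..<n} - {i}. if l = i then a else g l) = (\<Sum>l\<in>{..<n} - {i}. g l)"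
    by (intro sum.cong) auto
  then show ?thesis
    using assms by (simp add: sum.remove[of "{..<n}" i])
qed

text \<open>The additions in \<open>next_code\<close> act on each job separately: they only raise a
  0 to 1 or a 1 to 2, so there is no carry and \<open>d\<close> is the new digit pattern.\<close>

lemma next_code_digits:
  fixes j :: nat
  assumes "c < 3 ^ n" "i \<in> unscheduled c"
  defines "d \<equiv> \<lambda>l. if l = i then 1 else
      if time c j < r i \<and> digit c l = 1 then 2 else digit c l"
  shows "next_code c j i = (\<Sum>l<n. d l * 3 ^ l)"
proof -
  have i: "i < n" "digit c i = 0"
    using assms(2) by (auto simp: unscheduled_def)
  let ?g = "\<lambda>l. (if time c j < r i \<and> digit c l = 1 then 2 else digit c l) * 3 ^ l"
  have "(\<Sum>l<n. d l * 3 ^ l) = (\<Sum>l<n. if l = i then 3 ^ i else ?g l)"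
    by (intro sum.cong) (auto simp: d_def)
  also have "\<dots> = 3 ^ i + (\<Sum>l<n. ?g l)"
    using i by (intro sum_update) auto
  also have "(\<Sum>l<n. ?g l) = (\<Sum>l<n. digit c l * 3 ^ l) +
      (\<Sum>l<n. if time c j < r i \<and> digit c l = 1 then 3 ^ l else 0)"
    by (subst sum.distrib[symmetric], intro sum.cong) auto
  also have "(\<Sum>l<n. digit c l * 3 ^ l) = c"
    using code_eq_sum_digits[OF assms(1)] by simp
  finally show ?thesis
    by (auto simp: next_code_def block_code_def)
qed

lemma
  assumes "c < 3 ^ n" "i \<in> unscheduled c"
  shows next_code_less: "next_code c j i < 3 ^ n"
    and digit_next_code: "l < n \<Longrightarrow> digit (next_code c j i) l = (if l = i then 1 else
      if time c j < r i \<and> digit c l = 1 then 2 else digit c l)"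
  unfolding next_code_digits[OF assms]
  by (auto intro!: sum_digits_less simp: digit_sum_digits)

lemma next_code_greater: "c < next_code c j i"
  by (simp add: next_code_def)

lemma next_first_le: "i \<in> unscheduled c \<Longrightarrow> j \<le> n \<Longrightarrow> next_first c j i \<le> n"
  by (simp add: next_first_def unscheduled_def)

lemma finite_unscheduled [simp]: "finite (unscheduled c)"
  by (simp add: unscheduled_def)

lemma unscheduled_0: "unscheduled 0 = {..<n}"
  by (auto simp: unscheduled_def)

lemma unscheduled_next:
  "c < 3 ^ n \<Longrightarrow> i \<in> unscheduled c \<Longrightarrow> unscheduled (next_code c j i) = unscheduled c - {i}"
  by (auto simp: unscheduled_def digit_next_code split: if_splits)

lemma time_0: "time 0 n = 0"
  by (simp add: time_def block_start_def block_length_def)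

text \<open>With idle time, \<open>i\<close> alone forms the new block, which ends at
  \<open>r i + p i\<close>; otherwise the block keeps its start and grows by \<open>p i\<close>.
  Hence (c, j) keeps determining the completion time.\<close>

lemma time_next:
  assumes "c < 3 ^ n" "i \<in> unscheduled c"
  shows "time (next_code c j i) (next_first c j i) = finish (time c j) i"
proof -
  have i: "i < n" "digit c i = 0"
    using assms(2) by (auto simp: unscheduled_def)
  \<comment> \<open>This is the part of the old block that stays in the current one: all of it
    without idle time, nothing otherwise.\<close>
  let ?g = "\<lambda>l. if \<not> time c j < r i \<and> digit c l = 1 then p l else 0"
  have "block_length (next_code c j i) = (\<Sum>l<n. if l = i then p i else ?g l)"
    unfolding block_length_def using digit_next_code[OF assms] by (intro sum.cong) auto
  also have "\<dots> = p i + (\<Sum>l<n. ?g l)"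
    using i by (intro sum_update) auto
  finally show ?thesis
    using i by (auto simp: time_def[of "next_code c j i"] next_first_def finish_def block_start_def
        time_def[of c j] block_length_def[of c])
qed

text \<open>The block weight is accumulated from the top digit down, and these partial sums must fit
  into memory as well.\<close>

lemma block_code_part_less: "(\<Sum>i\<in>{k..<n}. if digit c i = 1 then 3 ^ i else 0) < (3::nat) ^ n"
proof -
  have "(\<Sum>i\<in>{k..<n}. if digit c i = 1 then 3 ^ i else 0) \<le> (\<Sum>i<n. 1 * (3::nat) ^ i)"
    by (intro order_trans[OF sum_mono sum_mono2]) auto
  also have "\<dots> < 3 ^ n"
    by (rule sum_digits_less) simp
  finally show ?thesis .
qed

end


section \<open>Weakest preconditions with step bounds\<close>

text \<open>Since \<open>exec\<close> is deterministic, a terminating run is the only one, so the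
  existential expresses total correctness within \<open>k\<close> steps.\<close>

definition wp ::
    "(nat \<Rightarrow> real \<Rightarrow> real) \<Rightarrow> nat \<Rightarrow> prog \<Rightarrow> nat \<Rightarrow> (state \<Rightarrow> bool) \<Rightarrow> state \<Rightarrow> bool" where
  "wp f m c k Q s \<longleftrightarrow> (\<exists>t s'. exec f m c s t s' \<and> t \<le> k \<and> Q s')"

lemma wp_mono: "wp f m c k Q s \<Longrightarrow> k \<le> k' \<Longrightarrow> (\<And>s. Q s \<Longrightarrow> Q' s) \<Longrightarrow> wp f m c k' Q' s"
  by (auto simp: wp_def intro: order_trans)

lemma wp_Seq: "wp f m c k (wp f m d l Q) s \<Longrightarrow> wp f m (Seq c d) (k + l) Q s"
  unfolding wp_def by (blast intro: exec.Seq add_mono)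

text \<open>The invariant is indexed by the number of completed rounds. Each round pays one step for
  its test besides the \<open>k\<close> of the body, and the outer \<open>Suc\<close> pays for the
  test that fails. The induction runs downwards from \<open>N\<close>, following the rounds that
  remain.\<close>

lemma wp_While:
  assumes "\<And>i s. i < N \<Longrightarrow> I i s \<Longrightarrow> holds b s \<and> wp f m c k (I (Suc i)) s"
    and "\<And>s. I N s \<Longrightarrow> \<not> holds b s"
    and "I 0 s"
  shows "wp f m (While b c) (Suc (N * Suc k)) (I N) s"
proof -
  have "wp f m (While b c) (Suc ((N - i) * Suc k)) (I N) s" if "i \<le> N" "I i s" for i s
    using that
  proof (induction i arbitrary: s rule: inc_induct)
    case base
    then show ?case
      using assms(2) by (auto simp: wp_def intro: exec.WhileFalse[unfolded One_nat_def])
  next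
    case (step i)
    then obtain t s' where s': "holds b s" "exec f m c s t s'" "t \<le> k" "I (Suc i) s'"
      using assms(1)[OF step.hyps(2) step.prems] by (auto simp: wp_def)
    from step.IH[OF s'(4)] obtain t' s'' where
      s'': "exec f m (While b c) s' t' s''" "t' \<le> Suc ((N - Suc i) * Suc k)" "I N s''"
      by (auto simp: wp_def)
    have "N - i = Suc (N - Suc i)"
      using step.hyps by simp
    then have "Suc (t + t') \<le> Suc ((N - i) * Suc k)"
      using s'(3) s''(2) by simp
    then show ?case
      using exec.WhileTrue[OF s'(1,2) s''(1)] s''(3) by (auto simp: wp_def)
  qed
  from this[of 0] show ?thesis
    using assms(3) by simp
qed

section \<open>Straight-line code and counting loops\<close>

primrec size_bound :: "prog \<Rightarrow> nat" where
  "size_bound Skip = 1"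
| "size_bound (Instr a) = 1"
| "size_bound (Seq c d) = size_bound c + size_bound d"
| "size_bound (Cond b c d) = Suc (max (size_bound c) (size_bound d))"
| "size_bound (While b c) = 0"

text \<open>Unfolding these equations lets the simplifier run loop-free code symbolically, without
  execution witnesses. Steps are counted separately by \<open>size_bound\<close>, whose value 0 on
  \<open>While\<close> is a default: here loops are mapped to False.\<close>

primrec loopfree_wp ::
    "(nat \<Rightarrow> real \<Rightarrow> real) \<Rightarrow> nat \<Rightarrow> prog \<Rightarrow> (state \<Rightarrow> bool) \<Rightarrow> state \<Rightarrow> bool" where
  "loopfree_wp f m Skip Q s \<longleftrightarrow> Q s"
| "loopfree_wp f m (Instr a) Q s \<longleftrightarrow> (\<exists>s'. run_instr f m a s = Some s' \<and> Q s')"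
| "loopfree_wp f m (Seq c d) Q s \<longleftrightarrow> loopfree_wp f m c (loopfree_wp f m d Q) s"
| "loopfree_wp f m (Cond b c d) Q s \<longleftrightarrow>
     (if holds b s then loopfree_wp f m c Q s else loopfree_wp f m d Q s)"
| "loopfree_wp f m (While b c) Q s \<longleftrightarrow> False"

lemma wp_loopfree: "loopfree_wp f m c Q s \<Longrightarrow> size_bound c \<le> k \<Longrightarrow> wp f m c k Q s"
proof -
  have "loopfree_wp f m c Q s \<Longrightarrow> wp f m c (size_bound c) Q s"
  proof (induction c arbitrary: s Q)
    case (Seq c d)
    have "loopfree_wp f m c (loopfree_wp f m d Q) s"
      using Seq.prems by simp
    then have "wp f m c (size_bound c) (loopfree_wp f m d Q) s"
      by (rule Seq.IH(1))
    then have "wp f m c (size_bound c) (wp f m d (size_bound d) Q) s"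
      by (rule wp_mono) (auto intro: Seq.IH(2))
    then show ?case
      by (simp add: wp_Seq)
  next
    case (Cond b c d)
    show ?case
    proof (cases "holds b s")
      case True
      then have "wp f m c (size_bound c) Q s"
        using Cond by simp
      then obtain t s' where "exec f m c s t s'" "t \<le> size_bound c" "Q s'"
        by (auto simp: wp_def)
      then show ?thesis
        using True by (auto simp: wp_def intro!: exI[of _ "Suc t"] exec.CondTrue)
    next
      case False
      then have "wp f m d (size_bound d) Q s"
        using Cond by simp
      then obtain t s' where "exec f m d s t s'" "t \<le> size_bound d" "Q s'"
        by (auto simp: wp_def)
      then show ?thesis
        using False by (auto simp: wp_def intro!: exI[of _ "Suc t"] exec.CondFalse)
    qed
  qed (auto simp: wp_def intro: exec.Skip[unfolded One_nat_def] exec.Instr[unfolded One_nat_def])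
  then show "loopfree_wp f m c Q s \<Longrightarrow> size_bound c \<le> k \<Longrightarrow> wp f m c k Q s"
    using wp_mono by blast
qed

text \<open>Possible failures appear as inequalities against \<open>m\<close> instead of an
  existential over successor states; the generic equation then leaves the simpset.\<close>

lemma loopfree_wp_instr [simp]:
  "loopfree_wp f m (Instr (WConst x k)) Q s \<longleftrightarrow>
     k < m \<and> Q (s\<lparr>wreg := (wreg s)(x := k)\<rparr>)"
  "loopfree_wp f m (Instr (WAdd x y z)) Q s \<longleftrightarrow>
     wreg s y + wreg s z < m \<and> Q (s\<lparr>wreg := (wreg s)(x := wreg s y + wreg s z)\<rparr>)"
  "loopfree_wp f m (Instr (WSub x y z)) Q s \<longleftrightarrow>
     wreg s y - wreg s z < m \<and> Q (s\<lparr>wreg := (wreg s)(x := wreg s y - wreg s z)\<rparr>)"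
  "loopfree_wp f m (Instr (WLoad x a i)) Q s \<longleftrightarrow>
     wreg s i < m \<and> Q (s\<lparr>wreg := (wreg s)(x := warr s a (wreg s i))\<rparr>)"
  "loopfree_wp f m (Instr (WStore a i x)) Q s \<longleftrightarrow>
     wreg s i < m \<and> Q (s\<lparr>warr := (warr s)(a := (warr s a)(wreg s i := wreg s x))\<rparr>)"
  "loopfree_wp f m (Instr (NAdd x' y' z')) Q s \<longleftrightarrow>
     Q (s\<lparr>nreg := (nreg s)(x' := nreg s y' + nreg s z')\<rparr>)"
  "loopfree_wp f m (Instr (NSub x' y' z')) Q s \<longleftrightarrow>
     Q (s\<lparr>nreg := (nreg s)(x' := nreg s y' - nreg s z')\<rparr>)"
  "loopfree_wp f m (Instr (NLoad x' a i)) Q s \<longleftrightarrow>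
     wreg s i < m \<and> Q (s\<lparr>nreg := (nreg s)(x' := narr s a (wreg s i))\<rparr>)"
  "loopfree_wp f m (Instr (NStore a i x')) Q s \<longleftrightarrow>
     wreg s i < m \<and> Q (s\<lparr>narr := (narr s)(a := (narr s a)(wreg s i := nreg s x'))\<rparr>)"
  "loopfree_wp f m (Instr (Oracle x' i y')) Q s \<longleftrightarrow>
     Q (s\<lparr>nreg := (nreg s)(x' := f (wreg s i) (nreg s y'))\<rparr>)"
  by auto

declare loopfree_wp.simps(2) [simp del]

lemma loopfree_wp_mono:
  "loopfree_wp f m c Q s \<Longrightarrow> (\<And>s. Q s \<Longrightarrow> Q' s) \<Longrightarrow> loopfree_wp f m c Q' s"
proof (induction c arbitrary: Q Q' s)
  case (Seq c d)
  have "loopfree_wp f m c (loopfree_wp f m d Q) s"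
    using Seq.prems by simp
  then have "loopfree_wp f m c (loopfree_wp f m d Q') s"
    by (rule Seq.IH(1)) (rule Seq.IH(2)[OF _ Seq.prems(2)])
  then show ?case by simp
qed (auto simp: loopfree_wp.simps(2) split: if_splits)

primrec block :: "instr list \<Rightarrow> prog" where
  "block [] = Skip"
| "block (a # as) = Seq (Instr a) (block as)"

definition For :: "name \<Rightarrow> name \<Rightarrow> prog \<Rightarrow> prog" where
  "For i b c = Seq (Instr (WConst i 0))
     (While (WLess i b) (Seq c (Instr (WAdd i i ''one''))))"

text \<open>The 2 outside the product pays for resetting the counter and for the failing test, the 2
  inside for the test and increment of each round. The body has to return the value 1 in
  \<open>''one''\<close>, because the increment adds that register.\<close>

lemma wp_For:
  assumes "N < m"
    and init: "I 0 (s\<lparr>wreg := (wreg s)(i := 0)\<rparr>)"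
    and regs: "\<And>k s. I k s \<Longrightarrow> wreg s i = k \<and> wreg s b = N"
    and body: "\<And>k s. k < N \<Longrightarrow> I k s \<Longrightarrow>
      wp f m c l (\<lambda>s. wreg s i = k \<and> wreg s ''one'' = 1 \<and>
        I (Suc k) (s\<lparr>wreg := (wreg s)(i := Suc k)\<rparr>)) s"
  shows "wp f m (For i b c) (2 + N * (l + 2)) (I N) s"
proof -
  have "wp f m (While (WLess i b) (Seq c (Instr (WAdd i i ''one'')))) (Suc (N * Suc (l + 1))) (I N)
      (s\<lparr>wreg := (wreg s)(i := 0)\<rparr>)"
  proof (rule wp_While)
    fix k s assume k: "k < N" "I k s"
    have "wp f m (Seq c (Instr (WAdd i i ''one''))) (l + 1) (I (Suc k)) s"
      using body[OF k] k(1) assms(1)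
      by (intro wp_Seq, elim wp_mono) (auto intro!: wp_loopfree)
    then show "holds (WLess i b) s \<and> wp f m (Seq c (Instr (WAdd i i ''one''))) (l + 1) (I (Suc k)) s"
      using k regs by simp
  qed (use init regs in auto)
  then have "wp f m (Instr (WConst i 0)) 1
      (wp f m (While (WLess i b) (Seq c (Instr (WAdd i i ''one'')))) (Suc (N * Suc (l + 1))) (I N)) s"
    using assms(1) by (intro wp_loopfree) auto
  from wp_Seq[OF this] show ?thesis
    by (simp add: For_def algebra_simps)
qed


section \<open>The program\<close>

abbreviation seq_prog :: "prog \<Rightarrow> prog \<Rightarrow> prog" (infixr ";;" 60) where
  "c ;; d \<equiv> Seq c d"

text \<open>Two additions triple \<open>N\<close>, which is left at 3^n, the bound of the main
  loop.\<close>

definition tabulate_power :: prog where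
  "tabulate_power = block [WStore ''pow'' ''i'' ''N'', WAdd ''x'' ''N'' ''N'', WAdd ''N'' ''N'' ''x'']"

definition tabulate_base :: prog where
  "tabulate_base = block [WStore ''base'' ''j'' ''b'', WAdd ''b'' ''b'' ''N'']"

definition setup_tables :: prog where
  "setup_tables =
     block [WConst ''one'' 1, WConst ''N'' 1, WAdd ''n1'' ''n'' ''one''] ;;
     For ''i'' ''n'' tabulate_power ;; For ''j'' ''n1'' tabulate_base"

text \<open>Digits are read from the top: \<open>3 ^ i\<close> is subtracted from the remainder as
  often as possible, at most twice, and the number of subtractions is the digit. Only a digit 1
  contributes to \<open>e\<close> and \<open>len\<close>.\<close>

definition decode_digit :: prog where
  "decode_digit =
     block [WSub ''i'' ''n'' ''one'', WSub ''i'' ''i'' ''l'', WLoad ''w'' ''pow'' ''i''] ;;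
     Cond (WLess ''rem'' ''w'')
       (Instr (WStore ''done'' ''i'' ''zero''))
       (block [WSub ''rem'' ''rem'' ''w'', WStore ''done'' ''i'' ''one''] ;;
        Cond (WLess ''rem'' ''w'')
          (block [WAdd ''e'' ''e'' ''w'', NLoad ''q'' ''p'' ''i'', NAdd ''len'' ''len'' ''q''])
          (Instr (WSub ''rem'' ''rem'' ''w'')))"

text \<open>\<open>y\<close> ends as the address of the successor state. \<open>u\<close> holds in
  turn the release date (when it is needed again), the completion time and the cost of job
  \<open>i\<close>.\<close>

definition evaluate_job :: prog where
  "evaluate_job =
     block [WLoad ''w'' ''pow'' ''i'', WAdd ''y'' ''c'' ''w'',
            NLoad ''u'' ''r'' ''i'', NLoad ''q'' ''p'' ''i''] ;;
     Cond (NLess ''t'' ''u'')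
       (block [WAdd ''y'' ''y'' ''e'', WLoad ''b'' ''base'' ''i'', NAdd ''u'' ''u'' ''q''])
       (block [WLoad ''b'' ''base'' ''j'', NAdd ''u'' ''t'' ''q'']) ;;
     block [WAdd ''y'' ''b'' ''y'', NLoad ''v'' ''value'' ''y'', Oracle ''u'' ''i'' ''u'',
            NAdd ''v'' ''u'' ''v'']"

definition record_job :: prog where
  "record_job = block [WAdd ''found'' ''one'' ''zero'', NAdd ''best'' ''v'' ''zero'',
     WAdd ''choice'' ''i'' ''zero'', WAdd ''next'' ''y'' ''zero'']"

text \<open>The flag \<open>found\<close> replaces an infinite initial value of \<open>best\<close>,
  which the machine cannot express.\<close>

definition try_job :: prog where
  "try_job =
     Instr (WLoad ''d'' ''done'' ''i'') ;;
     Cond (WLess ''d'' ''one'')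
       (evaluate_job ;;
        Cond (WLess ''found'' ''one'') record_job (Cond (NLess ''v'' ''best'') record_job Skip))
       Skip"

text \<open>Subtracting \<open>best\<close> from itself gives 0, the cost when no job is left. For
  \<open>j = n\<close> the first load reads cell \<open>n\<close> of \<open>r\<close>, initially 0,
  as the start of a block at time 0.\<close>

definition solve_state :: prog where
  "solve_state =
     block [NLoad ''t'' ''r'' ''j'', NAdd ''t'' ''t'' ''len'', NSub ''best'' ''best'' ''best'',
            WConst ''found'' 0] ;;
     For ''i'' ''n'' try_job ;;
     block [WLoad ''x'' ''base'' ''j'', WAdd ''x'' ''x'' ''c'', NStore ''value'' ''x'' ''best'',
            WStore ''choice'' ''x'' ''choice'', WStore ''next'' ''x'' ''next'']"

definition solve_code :: prog where
  "solve_code =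
     block [WSub ''c'' ''N'' ''one'', WSub ''c'' ''c'' ''k'', WAdd ''rem'' ''c'' ''zero'',
            WConst ''e'' 0, NSub ''len'' ''len'' ''len''] ;;
     For ''l'' ''n'' decode_digit ;; For ''j'' ''n1'' solve_state"

definition output_job :: prog where
  "output_job = block [WLoad ''y'' ''choice'' ''x'', WStore ''seq'' ''i'' ''y'',
     WLoad ''x'' ''next'' ''x'']"

definition scheduling_prog :: prog where
  "scheduling_prog =
     setup_tables ;; For ''k'' ''N'' solve_code ;;
     Instr (WLoad ''x'' ''base'' ''n'') ;; For ''i'' ''n'' output_job"


section \<open>Correctness\<close>

context scheduling_instance
begin

text \<open>The states need (n + 1) * 3^n cells. The additional 3^n leaves room for the last,
  unstored value produced while tabulating the multiples of 3^n.\<close>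

definition memory :: nat where
  "memory = (n + 2) * 3 ^ n"

definition index :: "nat \<Rightarrow> nat \<Rightarrow> nat" where
  "index c j = j * 3 ^ n + c"

lemma index_less: "c < 3 ^ n \<Longrightarrow> j \<le> n \<Longrightarrow> index c j < memory"
proof -
  assume "c < 3 ^ n" "j \<le> n"
  moreover from \<open>j \<le> n\<close> have "j * 3 ^ n \<le> n * 3 ^ n" by simp
  ultimately show ?thesis unfolding index_def memory_def add_mult_distrib by linarith
qed

text \<open>Division by 3^n recovers both components, so storing the result of one state leaves all
  other entries intact.\<close>

lemma index_eq_iff:
  assumes "c < 3 ^ n" "c' < 3 ^ n"
  shows "index c j = index c' j' \<longleftrightarrow> c = c' \<and> j = j'"
proof
  assume eq: "index c j = index c' j'"
  have "index c j mod 3 ^ n = c" "index c j div 3 ^ n = j"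
    "index c' j' mod 3 ^ n = c'" "index c' j' div 3 ^ n = j'"
    using assms by (auto simp: index_def)
  then show "c = c' \<and> j = j'" using eq by metis
qed auto

lemma less_memory:
  "k \<le> n + 1 \<Longrightarrow> k < memory" "k \<le> 3 ^ n \<Longrightarrow> k < memory" "i \<le> n \<Longrightarrow> 3 ^ i < memory"
proof -
  have *: "n + 2 \<le> memory" "2 * 3 ^ n \<le> memory" and pos: "0 < (3::nat) ^ n"
    unfolding memory_def using mult_le_mono2[of 1 "3 ^ n" "n + 2"] by simp_all
  show "k \<le> n + 1 \<Longrightarrow> k < memory" using *(1) by linarith
  show "k < memory" if "k \<le> 3 ^ n" for k
    using that *(2) pos by linarith
  then show "i \<le> n \<Longrightarrow> 3 ^ i < memory"
    by (simp add: power_increasing)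
qed

section \<open>Loop invariants\<close>

definition constants :: "state \<Rightarrow> bool" where
  "constants s \<longleftrightarrow> wreg s ''zero'' = 0 \<and> wreg s ''one'' = 1 \<and> wreg s ''n'' = n \<and>
     wreg s ''n1'' = n + 1 \<and> nreg s ''zero'' = 0 \<and>
     (\<forall>i<n. narr s ''p'' i = p i) \<and> (\<forall>j\<le>n. narr s ''r'' j = block_start j)"

definition ready :: "state \<Rightarrow> bool" where
  "ready s \<longleftrightarrow> constants s \<and> wreg s ''N'' = 3 ^ n \<and> (\<forall>i<n. warr s ''pow'' i = 3 ^ i) \<and>
     (\<forall>j\<le>n. warr s ''base'' j = j * 3 ^ n)"

text \<open>With no job left there is nothing to choose, so only the value is constrained; the other
  two arrays may hold stale entries there.\<close>

definition solved :: "state \<Rightarrow> nat \<Rightarrow> nat \<Rightarrow> bool" where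
  "solved s c j \<longleftrightarrow>
     narr s ''value'' (index c j) = optimal_cost (time c j) (unscheduled c) \<and>
     (unscheduled c \<noteq> {} \<longrightarrow>
        (let i = warr s ''choice'' (index c j)
         in i \<in> unscheduled c \<and>
            optimal_cost (time c j) (unscheduled c) = cost_via (time c j) (unscheduled c) i \<and>
            warr s ''next'' (index c j) = index (next_code c j i) (next_first c j i)))"

definition solved_from :: "nat \<Rightarrow> state \<Rightarrow> bool" where
  "solved_from c0 s \<longleftrightarrow> (\<forall>c j. c0 \<le> c \<and> c < 3 ^ n \<and> j \<le> n \<longrightarrow> solved s c j)"

definition code_inv :: "nat \<Rightarrow> nat \<Rightarrow> state \<Rightarrow> bool" where
  "code_inv k c s \<longleftrightarrow> ready s \<and> wreg s ''k'' = k \<and> wreg s ''c'' = c \<and> c < 3 ^ n \<and>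
     solved_from (Suc c) s"

text \<open>After \<open>l\<close> rounds the top \<open>l\<close> digits have been split off;
  \<open>rem\<close> keeps the lower \<open>n - l\<close>.\<close>

definition decode_inv :: "nat \<Rightarrow> nat \<Rightarrow> nat \<Rightarrow> state \<Rightarrow> bool" where
  "decode_inv k c l s \<longleftrightarrow> code_inv k c s \<and> wreg s ''l'' = l \<and>
     wreg s ''rem'' = c mod 3 ^ (n - l) \<and>
     (\<forall>i<n. n - l \<le> i \<longrightarrow> warr s ''done'' i = (if digit c i = 0 then 0 else 1)) \<and>
     wreg s ''e'' = (\<Sum>i\<in>{n - l..<n}. if digit c i = 1 then 3 ^ i else 0) \<and>
     nreg s ''len'' = (\<Sum>i\<in>{n - l..<n}. if digit c i = 1 then p i else 0)"

definition state_inv :: "nat \<Rightarrow> nat \<Rightarrow> nat \<Rightarrow> state \<Rightarrow> bool" where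
  "state_inv k c j s \<longleftrightarrow> code_inv k c s \<and> wreg s ''j'' = j \<and>
     (\<forall>i<n. warr s ''done'' i = (if digit c i = 0 then 0 else 1)) \<and>
     wreg s ''e'' = block_code c \<and> nreg s ''len'' = block_length c \<and>
     (\<forall>j'<j. solved s c j')"

text \<open>The condition says that no candidate below \<open>i\<close> has been met. It holds for
  every \<open>i\<close> when no job is left, and then \<open>best\<close> is already the correct
  value 0.\<close>

definition job_inv :: "nat \<Rightarrow> nat \<Rightarrow> nat \<Rightarrow> nat \<Rightarrow> state \<Rightarrow> bool" where
  "job_inv k c j i s \<longleftrightarrow> state_inv k c j s \<and> wreg s ''i'' = i \<and> nreg s ''t'' = time c j \<and>
     (if \<forall>i'\<in>unscheduled c. i \<le> i'
      then wreg s ''found'' = 0 \<and> nreg s ''best'' = 0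
      else wreg s ''found'' = 1 \<and> wreg s ''choice'' \<in> unscheduled c \<and>
        nreg s ''best'' = cost_via (time c j) (unscheduled c) (wreg s ''choice'') \<and>
        wreg s ''next'' =
          index (next_code c j (wreg s ''choice'')) (next_first c j (wreg s ''choice'')) \<and>
        (\<forall>i'\<in>unscheduled c. i' < i \<longrightarrow>
           nreg s ''best'' \<le> cost_via (time c j) (unscheduled c) i'))"

lemma decode_digit:
  assumes l: "l < n" and inv: "decode_inv k c l s"
  shows "loopfree_wp f memory decode_digit (\<lambda>s. wreg s ''l'' = l \<and> wreg s ''one'' = 1 \<and>
    decode_inv k c (Suc l) (s\<lparr>wreg := (wreg s)(''l'' := Suc l)\<rparr>)) s"
proof -
  define i where "i = n - Suc l"
  have i: "i < n" "n - l = Suc i" "n - Suc l = i" "n - 1 - l = i"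
    using l by (auto simp: i_def)
  have range: "{i..<n} = insert i {Suc i..<n}"
    using i(1) by auto
  have split: "\<And>l'. i \<le> l' \<longleftrightarrow> l' = i \<or> Suc i \<le> l'"
    by auto
  have less: "n - 1 < memory" "i < memory" "3 ^ i < memory"
    using i(1) less_memory(1)[of "n - 1"] less_memory(1)[of i] less_memory(3)[of i] by simp_all
  \<comment> \<open>The remainder at the start of the round is \<open>c mod 3 ^ Suc i\<close>;
    bounding it also bounds the results of the subtractions.\<close>
  have "c mod 3 ^ Suc i < 3 ^ Suc i" "(3::nat) ^ Suc i \<le> 3 ^ n"
    using i(1) by (simp_all del: power_Suc add: Suc_leI power_increasing)
  then have rem: "digit c i * 3 ^ i + c mod 3 ^ i < memory"
    unfolding mod_power_Suc[symmetric] by (intro less_memory) linarith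
  have e: "(\<Sum>i\<in>{i..<n}. if digit c i = 1 then 3 ^ i else 0) < memory"
    by (intro less_memory less_imp_le block_code_part_less)
  consider "digit c i = 0" | "digit c i = 1" | "digit c i = 2"
    using digit_less[of c i] by linarith
  then show ?thesis
    using inv l i less rem e
    by cases (auto simp: decode_digit_def decode_inv_def code_inv_def ready_def constants_def
        solved_from_def solved_def range mod_power_Suc split simp del: power_Suc)
qed

section \<open>Choosing the next job in one state\<close>

lemma state_inv_frame:
  assumes "state_inv k c j s" "warr s' = warr s" "narr s' = narr s"
    "\<forall>x\<in>{''zero'', ''one'', ''n'', ''n1'', ''N'', ''k'', ''c'', ''j'', ''e''}. wreg s' x = wreg s x"
    "\<forall>x\<in>{''zero'', ''len''}. nreg s' x = nreg s x"
  shows "state_inv k c j s'"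
proof -
  have "constants s' \<longleftrightarrow> constants s"
    using assms(2-) by (simp add: constants_def)
  moreover have "solved s' = solved s"
    using assms(2-) by (simp add: solved_def fun_eq_iff)
  ultimately have "state_inv k c j s' \<longleftrightarrow> state_inv k c j s"
    using assms(2-) by (simp add: state_inv_def code_inv_def ready_def solved_from_def)
  then show ?thesis
    using assms(1) by simp
qed

text \<open>Lists the registers the invariant depends on, so that code writing only scratch
  registers preserves it without unfolding.\<close>

lemma job_inv_frame:
  assumes "job_inv k c j i s" "warr s' = warr s" "narr s' = narr s"
    "\<forall>x\<in>{''zero'', ''one'', ''n'', ''n1'', ''N'', ''k'', ''c'', ''j'', ''e'', ''i'', ''found'',
        ''choice'', ''next''}. wreg s' x = wreg s x"
    "\<forall>x\<in>{''zero'', ''len'', ''t'', ''best''}. nreg s' x = nreg s x"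
  shows "job_inv k c j i s'"
proof -
  have "state_inv k c j s"
    using assms(1) unfolding job_inv_def by blast
  moreover from this have "state_inv k c j s'"
    by (rule state_inv_frame) (use assms(2-) in simp_all)
  ultimately have "job_inv k c j i s' \<longleftrightarrow> job_inv k c j i s"
    using assms(2-) by (simp add: job_inv_def)
  then show ?thesis
    using assms(1) by simp
qed

text \<open>The successor has a larger code, so its table entry is already correct; by
  \<open>time_next\<close> and \<open>unscheduled_next\<close> that entry is the remaining cost in
  \<open>cost_via\<close>.\<close>

lemma evaluate_job:
  assumes inv: "job_inv k c j i s" and ij: "i \<in> unscheduled c" "j \<le> n"
  shows "loopfree_wp f memory evaluate_job (\<lambda>s. job_inv k c j i s \<and>
    nreg s ''v'' = cost_via (time c j) (unscheduled c) i \<and>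
    wreg s ''y'' = index (next_code c j i) (next_first c j i)) s"
proof -
  have c: "c < 3 ^ n"
    using inv by (simp add: job_inv_def state_inv_def code_inv_def)
  have i: "i < n"
    using ij by (simp add: unscheduled_def)
  have next_le: "next_first c j i \<le> n"
    using ij by (simp add: next_first_le)
  note next_less = next_code_less[OF c ij(1), of j]
  have "solved s (next_code c j i) (next_first c j i)"
    using inv next_less next_le next_code_greater[of c j i]
    by (auto simp: job_inv_def state_inv_def code_inv_def solved_from_def Suc_le_eq)
  then have val: "narr s ''value'' (index (next_code c j i) (next_first c j i)) =
      optimal_cost (finish (time c j) i) (unscheduled c - {i})"
    using c ij by (simp add: solved_def time_next unscheduled_next)
  have index: "index (next_code c j i) (next_first c j i) < memory"
    using next_less next_le by (rule index_less)
  have code: "next_code c j i < memory"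
    using next_less by (intro less_memory) simp
  \<comment> \<open>In both cases \<open>c + 3 ^ i\<close> is at most
    \<open>next_code c j i\<close>, so the bound on the latter covers this intermediate sum.\<close>
  have mem: "c + 3 ^ i < memory" "i < memory" "j < memory"
    using code i ij less_memory(1)[of i] less_memory(1)[of j]
    by (simp_all add: next_code_def split: if_splits)
  have regs: "wreg s ''i'' = i" "wreg s ''c'' = c" "wreg s ''j'' = j" "wreg s ''e'' = block_code c"
    "warr s ''pow'' i = 3 ^ i" "warr s ''base'' i = i * 3 ^ n" "warr s ''base'' j = j * 3 ^ n"
    "narr s ''p'' i = p i" "narr s ''r'' i = r i" "nreg s ''t'' = time c j"
    using inv i ij by (simp_all add: job_inv_def state_inv_def code_inv_def ready_def constants_def
        block_start_def)
  show ?thesis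
  proof (cases "time c j < r i")
    case True
    then have "next_code c j i = c + 3 ^ i + block_code c" "next_first c j i = i"
      "finish (time c j) i = r i + p i"
      by (simp_all add: next_code_def next_first_def finish_def)
    with val index code mem True show ?thesis
      by (simp add: evaluate_job_def regs index_def cost_via_def)
        (rule job_inv_frame[OF inv]; simp)
  next
    case False
    then have "next_code c j i = c + 3 ^ i" "next_first c j i = j"
      "finish (time c j) i = time c j + p i"
      by (simp_all add: next_code_def next_first_def finish_def)
    with val index code mem False show ?thesis
      by (simp add: evaluate_job_def regs index_def cost_via_def)
        (rule job_inv_frame[OF inv]; simp)
  qed
qed

lemma record_job:
  assumes inv: "job_inv k c j i s" and i: "i \<in> unscheduled c"
    and v: "nreg s ''v'' = cost_via (time c j) (unscheduled c) i"
    and y: "wreg s ''y'' = index (next_code c j i) (next_first c j i)" "wreg s ''y'' < memory"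
  shows "loopfree_wp f memory
    (Cond (WLess ''found'' ''one'') record_job (Cond (NLess ''v'' ''best'') record_job Skip))
    (\<lambda>s. wreg s ''i'' = i \<and> wreg s ''one'' = 1 \<and>
      job_inv k c j (Suc i) (s\<lparr>wreg := (wreg s)(''i'' := Suc i)\<rparr>)) s"
proof -
  have inv': "state_inv k c j s" and regs: "wreg s ''i'' = i" "nreg s ''t'' = time c j"
    "wreg s ''zero'' = 0" "wreg s ''one'' = 1" "nreg s ''zero'' = 0"
    using inv by (simp_all add: job_inv_def state_inv_def code_inv_def ready_def constants_def)
  have mem: "i < memory" "1 < memory"
    using i by (auto intro!: less_memory(1) simp: unscheduled_def)
  have ne: "\<not> (\<forall>i'\<in>unscheduled c. Suc i \<le> i')"
    using i by force
  show ?thesis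
  proof (cases "\<forall>i'\<in>unscheduled c. i \<le> i'")
    case True
    then have "wreg s ''found'' = 0"
      using inv by (simp add: job_inv_def)
    \<comment> \<open>Job \<open>i\<close> is the first candidate, so the minimum so far ranges over
      it alone.\<close>
    moreover have "\<forall>i'\<in>unscheduled c. i' < Suc i \<longrightarrow> i' = i"
      using True by force
    ultimately show ?thesis
      using ne mem v y i
      by (auto simp: record_job_def regs job_inv_def state_inv_frame[OF inv'])
  next
    case False
    then have found: "wreg s ''found'' = 1"
      and best: "nreg s ''best'' = cost_via (time c j) (unscheduled c) (wreg s ''choice'')"
        "\<forall>i'\<in>unscheduled c. i' < i \<longrightarrow>
          nreg s ''best'' \<le> cost_via (time c j) (unscheduled c) i'"
      and choice: "wreg s ''choice'' \<in> unscheduled c" "wreg s ''next'' =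
        index (next_code c j (wreg s ''choice'')) (next_first c j (wreg s ''choice''))"
      using inv unfolding job_inv_def if_not_P[OF False] by blast+
    show ?thesis
    proof (cases "nreg s ''v'' < nreg s ''best''")
      case True
      then have "\<forall>i'\<in>unscheduled c. i' < Suc i \<longrightarrow>
          nreg s ''v'' \<le> cost_via (time c j) (unscheduled c) i'"
        using best(2) v by (auto simp: less_Suc_eq)
      with True show ?thesis
        using ne mem v y i found
        by (simp add: record_job_def regs job_inv_def state_inv_frame[OF inv'])
    next
      case False
      then have "\<forall>i'\<in>unscheduled c. i' < Suc i \<longrightarrow>
          nreg s ''best'' \<le> cost_via (time c j) (unscheduled c) i'"
        using best(2) v by (auto simp: less_Suc_eq)
      with False show ?thesis
        using ne best(1) choice found
        by (simp add: regs job_inv_def state_inv_frame[OF inv'])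
    qed
  qed
qed

lemma try_job:
  assumes inv: "job_inv k c j i s" and ij: "i < n" "j \<le> n"
  shows "loopfree_wp f memory try_job (\<lambda>s. wreg s ''i'' = i \<and> wreg s ''one'' = 1 \<and>
      job_inv k c j (Suc i) (s\<lparr>wreg := (wreg s)(''i'' := Suc i)\<rparr>)) s"
proof -
  let ?Q = "\<lambda>s. wreg s ''i'' = i \<and> wreg s ''one'' = 1 \<and>
      job_inv k c j (Suc i) (s\<lparr>wreg := (wreg s)(''i'' := Suc i)\<rparr>)"
  define s' where "s' = s\<lparr>wreg := (wreg s)(''d'' := warr s ''done'' i)\<rparr>"
  have s': "job_inv k c j i s'"
    unfolding s'_def by (rule job_inv_frame[OF inv]) simp_all
  have "i < memory"
    using ij by (auto intro!: less_memory(1))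
  moreover have regs: "wreg s ''i'' = i" "warr s ''done'' i = (if digit c i = 0 then 0 else 1)"
    "wreg s ''one'' = 1" "c < 3 ^ n"
    using inv ij by (simp_all add: job_inv_def state_inv_def code_inv_def ready_def constants_def)
  moreover have "job_inv k c j (Suc i) (s'\<lparr>wreg := (wreg s')(''i'' := Suc i)\<rparr>)"
    if "digit c i \<noteq> 0"
  proof -
    have "i \<notin> unscheduled c"
      using that by (simp add: unscheduled_def)
    \<comment> \<open>A scheduled job is no candidate: the bounds \<open>i\<close> and
      \<open>Suc i\<close> separate the unscheduled jobs in the same way.\<close>
    then have "Suc i \<le> i' \<longleftrightarrow> i \<le> i'" "i' < Suc i \<longleftrightarrow> i' < i" if "i' \<in> unscheduled c" for i'
      using that by (cases "i' = i"; auto)+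
    then have eq: "(\<forall>i'\<in>unscheduled c. Suc i \<le> i') \<longleftrightarrow> (\<forall>i'\<in>unscheduled c. i \<le> i')"
      "(\<forall>i'\<in>unscheduled c. i' < Suc i \<longrightarrow> P i') \<longleftrightarrow> (\<forall>i'\<in>unscheduled c. i' < i \<longrightarrow> P i')" for P
      by simp_all
    have "state_inv k c j s'"
      using s' unfolding job_inv_def by blast
    then have "state_inv k c j (s'\<lparr>wreg := (wreg s')(''i'' := Suc i)\<rparr>)"
      by (rule state_inv_frame) simp_all
    with \<open>state_inv k c j s'\<close> regs(1)
    have "job_inv k c j (Suc i) (s'\<lparr>wreg := (wreg s')(''i'' := Suc i)\<rparr>) \<longleftrightarrow> job_inv k c j i s'"
      unfolding job_inv_def eq by (simp add: s'_def)
    with s' show ?thesis by simp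
  qed
  moreover have "loopfree_wp f memory (evaluate_job ;;
      Cond (WLess ''found'' ''one'') record_job (Cond (NLess ''v'' ''best'') record_job Skip)) ?Q s'"
    if "digit c i = 0"
  proof -
    have i: "i \<in> unscheduled c"
      using that ij by (simp add: unscheduled_def)
    have "index (next_code c j i) (next_first c j i) < memory"
      using next_code_less[OF regs(4) i] next_first_le[OF i ij(2)] by (rule index_less)
    then have "loopfree_wp f memory
      (Cond (WLess ''found'' ''one'') record_job (Cond (NLess ''v'' ''best'') record_job Skip)) ?Q s''"
      if "job_inv k c j i s'' \<and> nreg s'' ''v'' = cost_via (time c j) (unscheduled c) i \<and>
        wreg s'' ''y'' = index (next_code c j i) (next_first c j i)" for s''
      using that i by (intro record_job) simp_all
    from loopfree_wp_mono[OF evaluate_job[OF s' i ij(2)] this]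
    show ?thesis unfolding loopfree_wp.simps(3) .
  qed
  ultimately show ?thesis
    by (simp add: try_job_def s'_def)
qed

lemma solved_update:
  assumes "narr s' ''value'' = (narr s ''value'')(index c j := v)"
    and "warr s' ''choice'' = (warr s ''choice'')(index c j := i)"
    and "warr s' ''next'' = (warr s ''next'')(index c j := y)"
    and "c < 3 ^ n" "c' < 3 ^ n"
  shows "solved s' c' j' \<longleftrightarrow>
    (if c' = c \<and> j' = j
     then v = optimal_cost (time c j) (unscheduled c) \<and>
       (unscheduled c \<noteq> {} \<longrightarrow> i \<in> unscheduled c \<and>
          optimal_cost (time c j) (unscheduled c) = cost_via (time c j) (unscheduled c) i \<and>
          y = index (next_code c j i) (next_first c j i))
     else solved s c' j')"
proof (cases "c' = c \<and> j' = j")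
  case True
  then show ?thesis using assms by (simp add: solved_def)
next
  case False
  then have "index c' j' \<noteq> index c j"
    using assms by (simp add: index_eq_iff)
  then show ?thesis unfolding if_not_P[OF False] using assms by (simp add: solved_def)
qed

lemma store_state:
  assumes inv: "job_inv k c j n s" and j: "j \<le> n"
  shows "loopfree_wp f memory
    (block [WLoad ''x'' ''base'' ''j'', WAdd ''x'' ''x'' ''c'', NStore ''value'' ''x'' ''best'',
      WStore ''choice'' ''x'' ''choice'', WStore ''next'' ''x'' ''next''])
    (\<lambda>s. wreg s ''j'' = j \<and> wreg s ''one'' = 1 \<and>
      state_inv k c (Suc j) (s\<lparr>wreg := (wreg s)(''j'' := Suc j)\<rparr>)) s"
proof -
  define s' where "s' = s\<lparr>wreg := (wreg s)(''x'' := index c j),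
    narr := (narr s)(''value'' := (narr s ''value'')(index c j := nreg s ''best'')),
    warr := (warr s)(''choice'' := (warr s ''choice'')(index c j := wreg s ''choice''),
      ''next'' := (warr s ''next'')(index c j := wreg s ''next''))\<rparr>"
  define s'' where "s'' = s'\<lparr>wreg := (wreg s')(''j'' := Suc j)\<rparr>"
  have inv': "state_inv k c j s"
    using inv unfolding job_inv_def by blast
  have regs: "wreg s ''j'' = j" "wreg s ''c'' = c" "wreg s ''one'' = 1" "c < 3 ^ n"
    "warr s ''base'' j = j * 3 ^ n"
    using inv' j by (simp_all add: state_inv_def code_inv_def ready_def constants_def)
  have best: "nreg s ''best'' = optimal_cost (time c j) (unscheduled c) \<and>
    (unscheduled c \<noteq> {} \<longrightarrow> wreg s ''choice'' \<in> unscheduled c \<and>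
      optimal_cost (time c j) (unscheduled c) =
        cost_via (time c j) (unscheduled c) (wreg s ''choice'') \<and>
      wreg s ''next'' =
        index (next_code c j (wreg s ''choice'')) (next_first c j (wreg s ''choice'')))"
  proof (cases "unscheduled c = {}")
    case True
    then show ?thesis
      using inv by (simp add: job_inv_def)
  next
    case False
    have less: "i < n" if "i \<in> unscheduled c" for i
      using that by (simp add: unscheduled_def)
    \<comment> \<open>Every candidate lies below \<open>n\<close>, so at the end of the loop the
      second branch of \<open>job_inv\<close> gives a minimum over all of them.\<close>
    then have "\<not> (\<forall>i\<in>unscheduled c. n \<le> i)"
      using False by force
    from inv[unfolded job_inv_def if_not_P[OF this]] have
      choice: "wreg s ''choice'' \<in> unscheduled c"
        "nreg s ''best'' = cost_via (time c j) (unscheduled c) (wreg s ''choice'')"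
        "wreg s ''next'' =
          index (next_code c j (wreg s ''choice'')) (next_first c j (wreg s ''choice''))"
      and min: "\<And>i. i \<in> unscheduled c \<Longrightarrow> nreg s ''best'' \<le> cost_via (time c j) (unscheduled c) i"
      using less by blast+
    have "optimal_cost (time c j) (unscheduled c) =
        cost_via (time c j) (unscheduled c) (wreg s ''choice'')"
      using choice(1) min unfolding choice(2) by (intro optimal_cost_eq_cost_via) auto
    with choice show ?thesis by simp
  qed
  have "solved s'' c' j' \<longleftrightarrow> c' = c \<and> j' = j \<or> solved s c' j'" if "c' < 3 ^ n" for c' j'
  proof -
    have "narr s'' ''value'' = (narr s ''value'')(index c j := nreg s ''best'')"
      "warr s'' ''choice'' = (warr s ''choice'')(index c j := wreg s ''choice'')"
      "warr s'' ''next'' = (warr s ''next'')(index c j := wreg s ''next'')"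
      by (simp_all add: s'_def s''_def)
    note update = solved_update[OF this regs(4) that, of j']
    show ?thesis
    proof (cases "c' = c \<and> j' = j")
      case True
      then show ?thesis using update[unfolded if_P[OF True]] best by blast
    next
      case False
      then show ?thesis using update[unfolded if_not_P[OF False]] by blast
    qed
  qed
  then have "solved_from (Suc c) s''" "\<forall>j'<Suc j. solved s'' c j'"
    using inv' regs(4) by (auto simp: state_inv_def code_inv_def solved_from_def less_Suc_eq)
  moreover have "ready s''"
    using inv' by (simp add: state_inv_def code_inv_def ready_def constants_def s'_def s''_def)
  ultimately have "state_inv k c (Suc j) s''"
    using inv' by (simp add: state_inv_def code_inv_def s'_def s''_def)
  moreover have "index c j < memory" "j < memory"
    using regs(4) j by (auto intro: index_less less_memory(1))
  moreover from this have "j * 3 ^ n < memory"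
    by (simp add: index_def)
  ultimately show ?thesis
    using regs by (simp add: s'_def s''_def index_def)
qed

text \<open>The bound is 5 + (2 + n * (38 + 2)) + 6 for initialization, loop and stores; 38 bounds
  \<open>try_job\<close> with some slack.\<close>

lemma solve_state:
  assumes inv: "state_inv k c j s" and j: "j \<le> n"
  shows "wp f memory solve_state (13 + n * 40) (\<lambda>s. wreg s ''j'' = j \<and> wreg s ''one'' = 1 \<and>
    state_inv k c (Suc j) (s\<lparr>wreg := (wreg s)(''j'' := Suc j)\<rparr>)) s"
proof -
  have mem: "j < memory" "0 < memory"
    using j by (auto intro!: less_memory(1))
  let ?init = "block [NLoad ''t'' ''r'' ''j'', NAdd ''t'' ''t'' ''len'',
    NSub ''best'' ''best'' ''best'', WConst ''found'' 0]"
  let ?store = "block [WLoad ''x'' ''base'' ''j'', WAdd ''x'' ''x'' ''c'',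
    NStore ''value'' ''x'' ''best'', WStore ''choice'' ''x'' ''choice'',
    WStore ''next'' ''x'' ''next'']"
  let ?Q = "\<lambda>s. wreg s ''j'' = j \<and> wreg s ''one'' = 1 \<and>
    state_inv k c (Suc j) (s\<lparr>wreg := (wreg s)(''j'' := Suc j)\<rparr>)"
  have "wreg s ''j'' = j" "narr s ''r'' j = block_start j" "nreg s ''len'' = block_length c"
    using inv j by (simp_all add: state_inv_def code_inv_def ready_def constants_def)
  then have init: "wp f memory ?init 5 (\<lambda>s. job_inv k c j 0 (s\<lparr>wreg := (wreg s)(''i'' := 0)\<rparr>)) s"
    using mem by (intro wp_loopfree)
      (simp_all add: job_inv_def time_def state_inv_frame[OF inv])
  have loop: "wp f memory (For ''i'' ''n'' try_job) (2 + n * (38 + 2)) (job_inv k c j n) s"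
    if "job_inv k c j 0 (s\<lparr>wreg := (wreg s)(''i'' := 0)\<rparr>)" for s
  proof (rule wp_For[where I = "job_inv k c j"])
    show "n < memory"
      by (auto intro!: less_memory(1))
    show "wp f memory try_job 38 (\<lambda>s. wreg s ''i'' = i \<and> wreg s ''one'' = 1 \<and>
        job_inv k c j (Suc i) (s\<lparr>wreg := (wreg s)(''i'' := Suc i)\<rparr>)) s"
      if "i < n" "job_inv k c j i s" for i s
      using try_job[OF that(2,1) j]
      by (rule wp_loopfree) (simp add: try_job_def evaluate_job_def record_job_def)
    show "wreg s ''i'' = i \<and> wreg s ''n'' = n" if "job_inv k c j i s" for i s
      using that by (simp add: job_inv_def state_inv_def code_inv_def ready_def constants_def)
  qed (rule that)
  have store: "wp f memory ?store 6 ?Q s" if "job_inv k c j n s" for s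
    using store_state[OF that j] by (rule wp_loopfree) simp
  have rest: "wp f memory (For ''i'' ''n'' try_job ;; ?store) ((2 + n * (38 + 2)) + 6) ?Q s"
    if "job_inv k c j 0 (s\<lparr>wreg := (wreg s)(''i'' := 0)\<rparr>)" for s
    by (rule wp_Seq[OF wp_mono[OF loop[OF that] order.refl store]])
  have "wp f memory solve_state (5 + ((2 + n * (38 + 2)) + 6)) ?Q s"
    unfolding solve_state_def
    by (rule wp_Seq[OF wp_mono[OF init order.refl rest]])
  then show ?thesis by simp
qed

lemma solve_code:
  assumes inv: "ready s" "wreg s ''k'' = k" "solved_from (3 ^ n - k) s" and k: "k < 3 ^ n"
  shows "wp f memory solve_code (10 + n * 24 + (n + 1) * (15 + n * 40))
    (\<lambda>s. wreg s ''k'' = k \<and> wreg s ''one'' = 1 \<and> ready s \<and> solved_from (3 ^ n - Suc k) s) s"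
proof -
  \<comment> \<open>Round \<open>k\<close> treats the \<open>k\<close>-th largest code, counting
    from 0, so exactly the codes above \<open>c\<close> are known to be solved.\<close>
  define c where "c = 3 ^ n - Suc k"
  have c: "c < 3 ^ n" "3 ^ n - Suc 0 - k = c" "Suc c = 3 ^ n - k"
    using k by (auto simp: c_def)
  let ?init = "block [WSub ''c'' ''N'' ''one'', WSub ''c'' ''c'' ''k'', WAdd ''rem'' ''c'' ''zero'',
    WConst ''e'' 0, NSub ''len'' ''len'' ''len'']"
  have "3 ^ n - Suc 0 < memory" "c < memory" "0 < memory"
    using c by (auto intro!: less_memory(2))
  then have init: "wp f memory ?init 6
      (\<lambda>s. decode_inv k c 0 (s\<lparr>wreg := (wreg s)(''l'' := 0)\<rparr>)) s"
    using inv c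
    by (intro wp_loopfree) (auto simp: decode_inv_def code_inv_def ready_def
        constants_def solved_from_def solved_def)
  have decode: "wp f memory (For ''l'' ''n'' decode_digit) (2 + n * (22 + 2)) (decode_inv k c n) s"
    if "decode_inv k c 0 (s\<lparr>wreg := (wreg s)(''l'' := 0)\<rparr>)" for s
  proof (rule wp_For[where I = "decode_inv k c"])
    show "n < memory"
      by (auto intro!: less_memory(1))
    show "wp f memory decode_digit 22 (\<lambda>s. wreg s ''l'' = l \<and> wreg s ''one'' = 1 \<and>
        decode_inv k c (Suc l) (s\<lparr>wreg := (wreg s)(''l'' := Suc l)\<rparr>)) s"
      if "l < n" "decode_inv k c l s" for l s
      using that by (intro wp_loopfree decode_digit) (auto simp: decode_digit_def)
  qed (use that in \<open>auto simp: decode_inv_def code_inv_def ready_def constants_def\<close>)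
  \<comment> \<open>At \<open>l = n\<close> the lower summation limit is 0, and the partial sums
    have become \<open>block_code c\<close> and \<open>block_length c\<close>.\<close>
  have decoded: "state_inv k c 0 (s\<lparr>wreg := (wreg s)(''j'' := 0)\<rparr>)" if "decode_inv k c n s" for s
    using that by (auto simp: decode_inv_def state_inv_def code_inv_def ready_def constants_def
        solved_from_def solved_def block_code_def block_length_def atLeast0LessThan)
  have states: "wp f memory (For ''j'' ''n1'' solve_state) (2 + (n + 1) * ((13 + n * 40) + 2))
      (state_inv k c (n + 1)) s"
    if "decode_inv k c n s" for s
  proof (rule wp_For[where I = "state_inv k c"])
    show "n + 1 < memory"
      by (auto intro!: less_memory(1))
    show "state_inv k c 0 (s\<lparr>wreg := (wreg s)(''j'' := 0)\<rparr>)"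
      using that by (rule decoded)
    show "wp f memory solve_state (13 + n * 40) (\<lambda>s. wreg s ''j'' = j \<and> wreg s ''one'' = 1 \<and>
        state_inv k c (Suc j) (s\<lparr>wreg := (wreg s)(''j'' := Suc j)\<rparr>)) s"
      if "j < n + 1" "state_inv k c j s" for j s
      using that by (intro solve_state) auto
  qed (auto simp: state_inv_def code_inv_def ready_def constants_def)
  have done_state: "wreg s ''k'' = k \<and> wreg s ''one'' = 1 \<and> ready s \<and> solved_from (3 ^ n - Suc k) s"
    if "state_inv k c (n + 1) s" for s
  proof -
    have "solved s c' j" if "c \<le> c'" "c' < 3 ^ n" "j \<le> n" for c' j
      using that \<open>state_inv k c (n + 1) s\<close>
      by (cases "c' = c") (auto simp: state_inv_def code_inv_def solved_from_def)
    then show ?thesis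
      using that by (auto simp: state_inv_def code_inv_def ready_def constants_def solved_from_def
          c_def[symmetric])
  qed
  have rest: "wp f memory (For ''l'' ''n'' decode_digit ;; For ''j'' ''n1'' solve_state)
      ((2 + n * (22 + 2)) + (2 + (n + 1) * ((13 + n * 40) + 2))) (state_inv k c (n + 1)) s"
    if "decode_inv k c 0 (s\<lparr>wreg := (wreg s)(''l'' := 0)\<rparr>)" for s
    by (rule wp_Seq[OF wp_mono[OF decode[OF that] order.refl states]])
  have "wp f memory solve_code (6 + ((2 + n * (22 + 2)) + (2 + (n + 1) * ((13 + n * 40) + 2))))
      (state_inv k c (n + 1)) s"
    unfolding solve_code_def
    by (rule wp_Seq[OF wp_mono[OF init order.refl rest]])
  then show ?thesis
    by (rule wp_mono) (use done_state in \<open>auto simp: algebra_simps\<close>)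
qed

section \<open>Tabulating powers and multiples\<close>

lemma constants_frame:
  assumes "constants s" "narr s' = narr s"
    "\<forall>x\<in>{''zero'', ''one'', ''n'', ''n1''}. wreg s' x = wreg s x" "nreg s' ''zero'' = nreg s ''zero''"
  shows "constants s'"
  using assms by (simp add: constants_def)

lemma setup_tables:
  "wp f memory setup_tables (8 + n * 6 + (n + 1) * 5) ready (initial_state n p r)"
proof -
  \<comment> \<open>\<open>N\<close> is the next power to be stored; \<open>b = 0\<close> is carried
    along as the starting value of the second loop.\<close>
  define power_inv where "power_inv i s \<longleftrightarrow> constants s \<and> wreg s ''i'' = i \<and> wreg s ''N'' = 3 ^ i \<and>
    wreg s ''b'' = 0 \<and> (\<forall>l<i. warr s ''pow'' l = 3 ^ l)" for i s
  define base_inv where "base_inv j s \<longleftrightarrow> constants s \<and> wreg s ''j'' = j \<and> wreg s ''N'' = 3 ^ n \<and>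
    wreg s ''b'' = j * 3 ^ n \<and> (\<forall>l<n. warr s ''pow'' l = 3 ^ l) \<and>
    (\<forall>l<j. warr s ''base'' l = l * 3 ^ n)" for j s
  let ?init = "block [WConst ''one'' 1, WConst ''N'' 1, WAdd ''n1'' ''n'' ''one'']"
  have init: "wp f memory ?init 4 (\<lambda>s. power_inv 0 (s\<lparr>wreg := (wreg s)(''i'' := 0)\<rparr>))
      (initial_state n p r)"
    using less_memory(1)[of 1] less_memory(1)[of "n + 1"]
    by (intro wp_loopfree)
      (simp_all add: power_inv_def constants_def initial_state_def block_start_def)
  have power: "wp f memory (For ''i'' ''n'' tabulate_power) (2 + n * (4 + 2)) (power_inv n) s"
    if "power_inv 0 (s\<lparr>wreg := (wreg s)(''i'' := 0)\<rparr>)" for s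
  proof (rule wp_For[where I = power_inv])
    show "n < memory"
      by (auto intro!: less_memory(1))
    show "wp f memory tabulate_power 4 (\<lambda>s. wreg s ''i'' = i \<and> wreg s ''one'' = 1 \<and>
        power_inv (Suc i) (s\<lparr>wreg := (wreg s)(''i'' := Suc i)\<rparr>)) s"
      if i: "i < n" and inv: "power_inv i s" for i s
    proof (rule wp_loopfree)
      have "3 ^ i + (3 ^ i + 3 ^ i) < memory"
        using less_memory(3)[of "Suc i"] i by simp
      moreover from this have "3 ^ i + 3 ^ i < memory"
        by linarith
      moreover have "i < memory"
        using i by (auto intro!: less_memory(1))
      moreover have "constants s" "wreg s ''i'' = i" "wreg s ''one'' = 1" "wreg s ''N'' = 3 ^ i"
        "wreg s ''b'' = 0" "\<forall>l<i. warr s ''pow'' l = 3 ^ l"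
        using inv by (simp_all add: power_inv_def constants_def)
      ultimately show "loopfree_wp f memory tabulate_power
          (\<lambda>s. wreg s ''i'' = i \<and> wreg s ''one'' = 1 \<and>
            power_inv (Suc i) (s\<lparr>wreg := (wreg s)(''i'' := Suc i)\<rparr>)) s"
        by (simp add: tabulate_power_def power_inv_def constants_frame[of s] less_Suc_eq)
    qed (simp add: tabulate_power_def)
    show "wreg s ''i'' = i \<and> wreg s ''n'' = n" if "power_inv i s" for i s
      using that by (simp add: power_inv_def constants_def)
  qed (rule that)
  have base: "wp f memory (For ''j'' ''n1'' tabulate_base) (2 + (n + 1) * (3 + 2)) (base_inv (n + 1)) s"
    if "power_inv n s" for s
  proof (rule wp_For[where I = base_inv])
    show "n + 1 < memory"
      by (auto intro!: less_memory(1))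
    show "wp f memory tabulate_base 3 (\<lambda>s. wreg s ''j'' = j \<and> wreg s ''one'' = 1 \<and>
        base_inv (Suc j) (s\<lparr>wreg := (wreg s)(''j'' := Suc j)\<rparr>)) s"
      if j: "j < n + 1" and inv: "base_inv j s" for j s
    proof (rule wp_loopfree)
      \<comment> \<open>The round \<open>j = n\<close> stores n * 3^n but still advances
        \<open>b\<close> to (n + 1) * 3^n, which explains the factor n + 2 in
        \<open>memory\<close>.\<close>
      have "Suc j * 3 ^ n \<le> (n + 1) * 3 ^ n"
        using j by (intro mult_right_mono) auto
      also have "\<dots> < memory"
        by (simp add: memory_def add_mult_distrib)
      finally have "j * 3 ^ n + 3 ^ n < memory"
        by (simp add: add.commute)
      moreover have "j < memory"
        using j by (auto intro!: less_memory(1))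
      moreover have "constants s" "wreg s ''j'' = j" "wreg s ''one'' = 1" "wreg s ''N'' = 3 ^ n"
        "wreg s ''b'' = j * 3 ^ n" "\<forall>l<n. warr s ''pow'' l = 3 ^ l"
        "\<forall>l<j. warr s ''base'' l = l * 3 ^ n"
        using inv by (simp_all add: base_inv_def constants_def)
      ultimately show "loopfree_wp f memory tabulate_base
          (\<lambda>s. wreg s ''j'' = j \<and> wreg s ''one'' = 1 \<and>
            base_inv (Suc j) (s\<lparr>wreg := (wreg s)(''j'' := Suc j)\<rparr>)) s"
        by (simp add: tabulate_base_def base_inv_def constants_frame[of s] less_Suc_eq add.commute)
    qed (simp add: tabulate_base_def)
    show "wreg s ''j'' = j \<and> wreg s ''n1'' = n + 1" if "base_inv j s" for j s
      using that by (simp add: base_inv_def constants_def)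
    show "base_inv 0 (s\<lparr>wreg := (wreg s)(''j'' := 0)\<rparr>)"
      using that by (simp add: power_inv_def base_inv_def constants_frame[of s])
  qed
  have rest: "wp f memory (For ''i'' ''n'' tabulate_power ;; For ''j'' ''n1'' tabulate_base)
      ((2 + n * (4 + 2)) + (2 + (n + 1) * (3 + 2))) (base_inv (n + 1)) s"
    if "power_inv 0 (s\<lparr>wreg := (wreg s)(''i'' := 0)\<rparr>)" for s
    by (rule wp_Seq[OF wp_mono[OF power[OF that] order.refl base]])
  have "wp f memory setup_tables (4 + ((2 + n * (4 + 2)) + (2 + (n + 1) * (3 + 2))))
      (base_inv (n + 1)) (initial_state n p r)"
    unfolding setup_tables_def
    by (rule wp_Seq[OF wp_mono[OF init order.refl rest]])
  then show ?thesis
    by (rule wp_mono) (simp_all add: base_inv_def ready_def)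
qed

section \<open>Reading off an optimal sequence\<close>

text \<open>Quantifying over all optimal continuations avoids any account of the cost already paid.
  The cardinality guarantees a job to output while \<open>i < n\<close> and none left at
  \<open>i = n\<close>.\<close>

definition output_inv :: "nat \<Rightarrow> state \<Rightarrow> bool" where
  "output_inv i s \<longleftrightarrow> wreg s ''i'' = i \<and> wreg s ''n'' = n \<and> wreg s ''one'' = 1 \<and> solved_from 0 s \<and>
     (\<exists>c j. c < 3 ^ n \<and> j \<le> n \<and> wreg s ''x'' = index c j \<and> card (unscheduled c) = n - i \<and>
       (\<forall>\<tau>. optimal_from (time c j) (unscheduled c) \<tau> \<longrightarrow>
         optimal_from 0 {..<n} (map (warr s ''seq'') [0..<i] @ \<tau>)))"

lemma output_job:
  assumes i: "i < n" and inv: "output_inv i s"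
  shows "loopfree_wp f memory output_job (\<lambda>s. wreg s ''i'' = i \<and> wreg s ''one'' = 1 \<and>
    output_inv (Suc i) (s\<lparr>wreg := (wreg s)(''i'' := Suc i)\<rparr>)) s"
proof -
  obtain c j where c: "c < 3 ^ n" "j \<le> n" "wreg s ''x'' = index c j"
      "card (unscheduled c) = n - i"
    and opt: "\<And>\<tau>. optimal_from (time c j) (unscheduled c) \<tau> \<Longrightarrow>
      optimal_from 0 {..<n} (map (warr s ''seq'') [0..<i] @ \<tau>)"
    using inv unfolding output_inv_def by blast
  define a where "a = warr s ''choice'' (index c j)"
  have regs: "wreg s ''i'' = i" "wreg s ''n'' = n" "wreg s ''one'' = 1" "solved_from 0 s"
    using inv by (simp_all add: output_inv_def)
  have "unscheduled c \<noteq> {}"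
    using c(4) i by force
  moreover have "solved s c j"
    using regs(4) c by (simp add: solved_from_def)
  ultimately have a: "a \<in> unscheduled c"
      "optimal_cost (time c j) (unscheduled c) = cost_via (time c j) (unscheduled c) a"
      "warr s ''next'' (index c j) = index (next_code c j a) (next_first c j a)"
    by (simp_all add: solved_def a_def Let_def)
  define s' where "s' = s\<lparr>warr := (warr s)(''seq'' := (warr s ''seq'')(i := a)),
      wreg := (wreg s)(''y'' := a, ''x'' := warr s ''next'' (index c j), ''i'' := Suc i)\<rparr>"
  have seq: "map (warr s' ''seq'') [0..<Suc i] = map (warr s ''seq'') [0..<i] @ [a]"
    by (simp add: s'_def)
  have "optimal_from 0 {..<n} (map (warr s' ''seq'') [0..<Suc i] @ \<tau>)"
    if "optimal_from (time (next_code c j a) (next_first c j a)) (unscheduled (next_code c j a)) \<tau>"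
    for \<tau>
  proof -
    \<comment> \<open>The stored choice attains Bellman's minimum, so \<open>a\<close> may be put
      before any optimal continuation of the successor.\<close>
    have "optimal_from (time c j) (unscheduled c) (a # \<tau>)"
      using a c that by (intro optimal_from_Cons) (simp_all add: time_next unscheduled_next)
    from opt[OF this] show ?thesis
      unfolding seq by simp
  qed
  moreover have "card (unscheduled (next_code c j a)) = n - Suc i"
    using a c i by (simp add: unscheduled_next)
  moreover have "next_code c j a < 3 ^ n" "next_first c j a \<le> n"
    using a c by (simp_all add: next_code_less next_first_le)
  moreover have "solved s' = solved s"
    by (simp add: solved_def fun_eq_iff s'_def)
  then have "solved_from 0 s'"
    using regs(4) by (simp add: solved_from_def)
  moreover have "wreg s' ''i'' = Suc i" "wreg s' ''n'' = n" "wreg s' ''one'' = 1"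
      "wreg s' ''x'' = index (next_code c j a) (next_first c j a)"
    using regs a by (simp_all add: s'_def)
  ultimately have "output_inv (Suc i) s'"
    unfolding output_inv_def by blast
  moreover have "index c j < memory" "i < memory"
    using c i by (auto intro: index_less less_memory(1))
  ultimately show ?thesis
    using regs c by (simp add: output_job_def s'_def a_def fun_upd_twist)
qed

lemma optimal_sequence_of_output:
  assumes "output_inv n s"
  shows "optimal_sequence n p r f (output_sequence n s)"
proof -
  obtain c j where card: "card (unscheduled c) = n - n"
    and opt: "\<And>\<tau>. optimal_from (time c j) (unscheduled c) \<tau> \<Longrightarrow>
      optimal_from 0 {..<n} (map (warr s ''seq'') [0..<n] @ \<tau>)"
    using assms unfolding output_inv_def by blast
  have "optimal_from (time c j) (unscheduled c) []"
    using card by (simp add: optimal_from_def)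
  from opt[OF this] show ?thesis
    by (simp add: output_sequence_def optimal_from_imp_optimal_sequence)
qed

section \<open>Whole program and resource bounds\<close>

definition steps :: nat where
  "steps = (8 + n * 6 + (n + 1) * 5) +
     ((2 + 3 ^ n * ((10 + n * 24 + (n + 1) * (15 + n * 40)) + 2)) + (1 + (2 + n * (4 + 2))))"

lemma scheduling_prog:
  "wp f memory scheduling_prog steps (\<lambda>s. optimal_sequence n p r f (output_sequence n s))
     (initial_state n p r)"
proof -
  let ?codes = "\<lambda>k s. ready s \<and> wreg s ''k'' = k \<and> solved_from (3 ^ n - k) s"
  have codes: "wp f memory (For ''k'' ''N'' solve_code)
      (2 + 3 ^ n * ((10 + n * 24 + (n + 1) * (15 + n * 40)) + 2)) (?codes (3 ^ n)) s"
    if "ready s" for s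
  proof (rule wp_For[where I = "?codes"])
    show "3 ^ n < memory"
      by (rule less_memory(3)) simp
    show "?codes 0 (s\<lparr>wreg := (wreg s)(''k'' := 0)\<rparr>)"
      using that by (auto simp: ready_def constants_def solved_from_def)
    show "wreg s ''k'' = k \<and> wreg s ''N'' = 3 ^ n" if "?codes k s" for k s
      using that by (simp add: ready_def)
    show "wp f memory solve_code (10 + n * 24 + (n + 1) * (15 + n * 40))
        (\<lambda>s. wreg s ''k'' = k \<and> wreg s ''one'' = 1 \<and> ?codes (Suc k) (s\<lparr>wreg := (wreg s)(''k'' := Suc k)\<rparr>)) s"
      if k: "k < 3 ^ n" and inv: "?codes k s" for k s
    proof (rule wp_mono[OF solve_code[OF _ _ _ k] order.refl])
      fix s assume s: "wreg s ''k'' = k \<and> wreg s ''one'' = 1 \<and> ready s \<and>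
        solved_from (3 ^ n - Suc k) s"
      moreover have "solved (s\<lparr>wreg := (wreg s)(''k'' := Suc k)\<rparr>) = solved s"
        by (simp add: solved_def fun_eq_iff)
      ultimately show "wreg s ''k'' = k \<and> wreg s ''one'' = 1 \<and>
          ?codes (Suc k) (s\<lparr>wreg := (wreg s)(''k'' := Suc k)\<rparr>)"
        by (simp add: solved_from_def ready_def constants_def)
    qed (use inv in auto)
  qed
  have init: "wp f memory (Instr (WLoad ''x'' ''base'' ''n'')) 1
      (\<lambda>s. output_inv 0 (s\<lparr>wreg := (wreg s)(''i'' := 0)\<rparr>)) s" if "?codes (3 ^ n) s" for s
  proof (rule wp_loopfree)
    \<comment> \<open>The walk starts at code 0 with \<open>j = n\<close>: all jobs are unscheduled
      and the time is 0.\<close>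
    let ?s = "s\<lparr>wreg := (wreg s)(''x'' := index 0 n, ''i'' := 0)\<rparr>"
    have "solved ?s = solved s"
      by (simp add: solved_def fun_eq_iff)
    then have "output_inv 0 ?s"
      using that unfolding output_inv_def
      by (intro conjI exI[of _ 0] exI[of _ n])
        (simp_all add: ready_def constants_def solved_from_def unscheduled_0 time_0)
    then show "loopfree_wp f memory (Instr (WLoad ''x'' ''base'' ''n''))
        (\<lambda>s. output_inv 0 (s\<lparr>wreg := (wreg s)(''i'' := 0)\<rparr>)) s"
      using that less_memory(1)[of n] by (simp add: ready_def constants_def index_def)
  qed simp
  have outputs: "wp f memory (For ''i'' ''n'' output_job) (2 + n * (4 + 2)) (output_inv n) s"
    if "output_inv 0 (s\<lparr>wreg := (wreg s)(''i'' := 0)\<rparr>)" for s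
  proof (rule wp_For[where I = output_inv])
    show "n < memory"
      by (auto intro!: less_memory(1))
    show "wp f memory output_job 4 (\<lambda>s. wreg s ''i'' = i \<and> wreg s ''one'' = 1 \<and>
        output_inv (Suc i) (s\<lparr>wreg := (wreg s)(''i'' := Suc i)\<rparr>)) s"
      if "i < n" "output_inv i s" for i s
      using output_job[OF that] by (rule wp_loopfree) (simp add: output_job_def)
    show "wreg s ''i'' = i \<and> wreg s ''n'' = n" if "output_inv i s" for i s
      using that by (simp add: output_inv_def)
  qed (rule that)
  have rest: "wp f memory (Instr (WLoad ''x'' ''base'' ''n'') ;; For ''i'' ''n'' output_job)
      (1 + (2 + n * (4 + 2))) (output_inv n) s" if "?codes (3 ^ n) s" for s
    by (rule wp_Seq[OF wp_mono[OF init[OF that] order.refl outputs]])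
  have rest': "wp f memory
      (For ''k'' ''N'' solve_code ;; Instr (WLoad ''x'' ''base'' ''n'') ;; For ''i'' ''n'' output_job)
      ((2 + 3 ^ n * ((10 + n * 24 + (n + 1) * (15 + n * 40)) + 2)) + (1 + (2 + n * (4 + 2))))
      (output_inv n) s" if "ready s" for s
    by (rule wp_Seq[OF wp_mono[OF codes[OF that] order.refl rest]])
  have "wp f memory scheduling_prog steps (output_inv n) (initial_state n p r)"
    unfolding scheduling_prog_def steps_def
    by (rule wp_Seq[OF wp_mono[OF setup_tables order.refl rest']])
  then show ?thesis
    by (rule wp_mono) (auto intro: optimal_sequence_of_output)
qed

text \<open>Terms outside the main loop are absorbed using \<open>1 \<le> 3 ^ n\<close>. The factor
  of 3^n is then 40 n^2 + 99 n + 47, which is below 100 (n + 1)^2.\<close>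

lemma steps_le: "steps \<le> 100 * (n + 1) ^ 2 * 3 ^ n"
proof -
  have "8 + n * 6 + (n + 1) * 5 + (2 + (1 + (2 + n * (4 + 2)))) \<le> 20 * (n + 1) * (1::nat)"
    by simp
  also have "\<dots> \<le> 20 * (n + 1) * 3 ^ n"
    by (intro mult_left_mono) simp_all
  finally have "steps \<le> (20 * (n + 1) + (10 + n * 24 + (n + 1) * (15 + n * 40) + 2)) * 3 ^ n"
    by (simp add: steps_def algebra_simps)
  also have "\<dots> \<le> 100 * (n + 1) ^ 2 * 3 ^ n"
    by (intro mult_right_mono) (simp_all add: power2_eq_square algebra_simps)
  finally show ?thesis .
qed

end

lemma Ostar_3_powerI:
  assumes "\<And>n. h n \<le> c * (n + 1) ^ k * 3 ^ n"
  shows "(\<lambda>n. real (h n)) \<in> Ostar (\<lambda>n. 3 ^ n)"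
proof -
  \<comment> \<open>\<open>[:1, 1:]\<close> is the polynomial x + 1, so the witness is c (x +
    1)^k.\<close>
  have "norm (real (h n)) \<le> 1 * norm (poly (smult (real c) ([:1, 1:] ^ k)) (real n) * 3 ^ n)" for n
  proof -
    have "real (h n) \<le> real (c * (n + 1) ^ k * 3 ^ n)"
      using assms by (simp only: of_nat_le_iff)
    then show ?thesis
      by (simp add: abs_mult algebra_simps)
  qed
  then have "(\<lambda>n. real (h n)) \<in> O(\<lambda>n. poly (smult (real c) ([:1, 1:] ^ k)) (real n) * 3 ^ n)"
    by (intro bigoI[of _ 1]) simp
  then show ?thesis
    unfolding Ostar_def by blast
qed

theorem theorem2p5:
  "\<exists>(c :: prog) (T :: nat \<Rightarrow> nat) (S :: nat \<Rightarrow> nat).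
     solves_scheduling c T S \<and>
     (\<lambda>n. real (T n)) \<in> Ostar (\<lambda>n. 3 ^ n) \<and>
     (\<lambda>n. real (S n)) \<in> Ostar (\<lambda>n. 3 ^ n)"
proof (intro exI conjI)
  \<comment> \<open>Outside the locale, \<open>steps\<close> and \<open>memory\<close> are functions
    of \<open>n\<close> alone, and the program is one fixed term, so the bounds are uniform over all
    instances.\<close>
  show "solves_scheduling scheduling_prog scheduling_instance.steps scheduling_instance.memory"
    unfolding solves_scheduling_def
    using scheduling_instance.less_memory(1) scheduling_instance.scheduling_prog
    by (fastforce simp: wp_def)
  show "(\<lambda>n. real (scheduling_instance.steps n)) \<in> Ostar (\<lambda>n. 3 ^ n)"
    by (rule Ostar_3_powerI) (rule scheduling_instance.steps_le)
  show "(\<lambda>n. real (scheduling_instance.memory n)) \<in> Ostar (\<lambda>n. 3 ^ n)"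
    \<comment> \<open>The constants 2 and 1 come from n + 2 \<le> 2 (n + 1).\<close>
    by (rule Ostar_3_powerI[of _ 2 1]) (simp add: scheduling_instance.memory_def)
qed

end
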